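(* Suppose that $(\breve L,W)$ is a complete reflection lattice such that $(\mathbb{Q}\otimes\breve L,W)$ decomposes as a product $(V_1,W_1)\times(\mathbb{Q}\otimes L_\Delta,W_\Delta)$. Then $(\breve L,W)$ decomposes as the product $(\breve L\cap V_1,W_1)\times(L_\Delta,W_\Delta)$ of complete reflection lattices. If $(\breve L,W)$ is marked, then there is a unique way to mark the two factors of the product so that the product decomposition respects the markings.
   Context: A complete lattice is a finitely generated free $\mathbb{Z}_2$-module; a reflection is an automorphism conjugate in $GL(r,\mathbb{Q}_2)$ to $\mathrm{diag}(-1,1,\dots,1)$; a complete reflection lattice is $(\breve L,W)$ with $W\subset\mathrm{Aut}(\breve L)$ finite and generated by its reflections. A product $(A,W)\times(A',W')$ is $(A\times A',W\times W')$ with the evident action; a decomposition of $(\mathbb{Q}\otimes\breve L,W)$ as a product means $\mathbb{Q}\otimes\breve L=V_1\times V_2$, $W=W_1\times W_2$ with $W_k$ acting on $V_k$ and trivially on the other factor. A marking of a reflection $\sigma$ is an equivalence class of pairs $(b,\beta)$ with $b\in\breve L$, $\beta:\breve L\to\mathbb{Z}_2$, $\sigma(x)=x+\beta(x)b$, modulo $(b,\beta)\sim(ub,u^{-1}\beta)$ for units $u$; a marked complete reflection lattice assigns such a marking to each reflection of $W$ compatibly with conjugation by $W$. $(L_\Delta,W_\Delta)$ is the rank $3$ complete reflection lattice associated to the exceptional $2$-compact group $\mathrm{DI}(4)$ (the action of its Weyl group on $\mathrm{Hom}(\mathbb{Z}/2^\infty,\breve T)$, $\breve T$ its maximal $2$-discrete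 torus); $W_\Delta\cong\mathbb{Z}/2\times GL(3,\mathbb{F}_2)$, the central $\mathbb{Z}/2$ acts by $-1$, $W_\Delta$ acts on $L_\Delta/2$ via the natural representation of $GL(3,\mathbb{F}_2)$, and all reflections of $W_\Delta$ are nontrivial mod $2$. *)

theory Defs
  imports "HOL-Analysis.Analysis" "HOL-Library.Z2"
begin

section \<open>The 2-adic integers\<close>

text \<open>A 2-adic integer is a compatible system of residues x_n in [0, 2^n),
  i.e. an element of the inverse limit of the rings Z/2^n.\<close>

typedef z2 = "{f :: nat \<Rightarrow> int. \<forall>n. 0 \<le> f n \<and> f n < 2 ^ n \<and> f (Suc n) mod 2 ^ n = f n}"
  morphisms digits Abs_z2
  by (rule exI[of _ "\<lambda>n. 0"]) simp

setup_lifting type_definition_z2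

lemma z2_mod_Suc: "(x :: int) mod 2 ^ Suc n mod 2 ^ n = x mod 2 ^ n"
  by (simp add: mod_mod_cancel)

lemma z2_mod_Suc': "(x :: int) mod (2 * 2 ^ n) mod 2 ^ n = x mod 2 ^ n"
  using z2_mod_Suc[of x n] by simp

declare z2_mod_Suc'[simp]

instantiation z2 :: comm_ring_1
begin

lift_definition zero_z2 :: z2 is "\<lambda>n. 0" by simp

lift_definition one_z2 :: z2 is "\<lambda>n. 1 mod 2 ^ n"
  by (simp add: z2_mod_Suc)

definition z2_ok :: "(nat \<Rightarrow> int) \<Rightarrow> bool" where
  "z2_ok f \<longleftrightarrow> (\<forall>n. 0 \<le> f n \<and> f n < 2 ^ n \<and> f (Suc n) mod 2 ^ n = f n)"

lemma z2_ok_add: "z2_ok f \<Longrightarrow> z2_ok g \<Longrightarrow> z2_ok (\<lambda>n. (f n + g n) mod 2 ^ n)"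
  unfolding z2_ok_def
  by (auto simp del: power_Suc simp add: z2_mod_Suc) (metis mod_add_eq)

lemma z2_ok_mult: "z2_ok f \<Longrightarrow> z2_ok g \<Longrightarrow> z2_ok (\<lambda>n. (f n * g n) mod 2 ^ n)"
  unfolding z2_ok_def
  by (auto simp del: power_Suc simp add: z2_mod_Suc) (metis mod_mult_eq)

lemma z2_ok_minus: "z2_ok f \<Longrightarrow> z2_ok (\<lambda>n. (- f n) mod 2 ^ n)"
  unfolding z2_ok_def
  by (auto simp del: power_Suc simp add: z2_mod_Suc) (metis mod_minus_eq)

lift_definition plus_z2 :: "z2 \<Rightarrow> z2 \<Rightarrow> z2" is "\<lambda>f g n. (f n + g n) mod 2 ^ n"
  using z2_ok_add unfolding z2_ok_def by blast

lift_definition times_z2 :: "z2 \<Rightarrow> z2 \<Rightarrow> z2" is "\<lambda>f g n. (f n * g n) mod 2 ^ n"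
  using z2_ok_mult unfolding z2_ok_def by blast

lift_definition uminus_z2 :: "z2 \<Rightarrow> z2" is "\<lambda>f n. (- f n) mod 2 ^ n"
  using z2_ok_minus unfolding z2_ok_def by blast

definition minus_z2 :: "z2 \<Rightarrow> z2 \<Rightarrow> z2" where "minus_z2 a b = a + (- b)"

lemma z2_eqI: "(\<And>n. digits a n = digits b n) \<Longrightarrow> a = b"
  by (metis digits_inject ext)

lemma z2_digits_mod: "digits a n mod 2 ^ n = digits a n"
  using digits[of a] by simp

instance
proof
  fix a b c :: z2
  show "a + b + c = a + (b + c)"
    by (rule z2_eqI, transfer) (simp add: mod_simps ac_simps)
  show "a + b = b + a"
    by (rule z2_eqI, transfer) (simp add: ac_simps)
  show "0 + a = a"
    by (rule z2_eqI, transfer) simp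
  show "- a + a = 0"
    by (rule z2_eqI, transfer) (simp add: mod_simps)
  show "a - b = a + - b" by (simp add: minus_z2_def)
  show "a * b * c = a * (b * c)"
    by (rule z2_eqI, transfer) (simp add: mod_simps ac_simps)
  show "a * b = b * a"
    by (rule z2_eqI, transfer) (simp add: ac_simps)
  show "1 * a = a"
  proof (rule z2_eqI)
    fix n show "digits (1 * a) n = digits a n"
    proof (cases n)
      case 0
      have "0 \<le> digits a 0" "digits a 0 < 1" using spec[OF digits[of a, simplified], of 0] by auto
      then show ?thesis using 0 by (simp add: times_z2.rep_eq one_z2.rep_eq)
    next
      case (Suc m)
      then show ?thesis using digits[of a] by (auto simp add: times_z2.rep_eq one_z2.rep_eq)
    qed
  qed
  show "(a + b) * c = a * c + b * c"
    by (rule z2_eqI, transfer) (simp add: mod_simps algebra_simps)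
  show "(0::z2) \<noteq> 1"
  proof
    assume "(0::z2) = 1"
    then have "digits (0::z2) 1 = digits (1::z2) 1" by simp
    then show False by (simp add: zero_z2.rep_eq one_z2.rep_eq)
  qed
qed

end

definition z2_unit :: "z2 \<Rightarrow> bool" where
  "z2_unit u \<longleftrightarrow> (\<exists>v. u * v = 1)"

section \<open>Complete lattices, reflections, complete reflection lattices\<close>

text \<open>A complete lattice of rank r is identified with z2^'n, CARD('n) = r
  (every finitely generated free Z_2-module is isomorphic to such).
  Automorphisms are the matrices with unit determinant.\<close>

definition lat_aut :: "z2^'n^'n \<Rightarrow> bool" where
  "lat_aut A \<longleftrightarrow> z2_unit (det A)"

definition diag_refl :: "'n::finite \<Rightarrow> z2^'n^'n" where
  "diag_refl i0 = (\<chi> i j. if i = j then (if i = i0 then - 1 else 1) else 0)"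

text \<open>Reflection: an automorphism conjugate in GL(r,Q_2) to diag(-1,1,...,1).
  A matrix P in GL(r,Q_2) may be scaled by a power of 2 to have entries in Z_2;
  invertibility over Q_2 = Frac(Z_2) is then det P \<noteq> 0.\<close>

definition is_reflection :: "z2^'n^'n \<Rightarrow> bool" where
  "is_reflection \<sigma> \<longleftrightarrow> lat_aut \<sigma> \<and>
     (\<exists>(P :: z2^'n^'n) i0. det P \<noteq> 0 \<and> P ** \<sigma> = diag_refl i0 ** P)"

text \<open>Submonoid generated by a set of matrices (for a finite group of invertible
  matrices this is the subgroup generated).\<close>

inductive_set mgen :: "('a::semiring_1^'n^'n) set \<Rightarrow> ('a^'n^'n) set" for S where
  mgen_one: "mat 1 \<in> mgen S"
| mgen_mult: "a \<in> S \<Longrightarrow> b \<in> mgen S \<Longrightarrow> a ** b \<in> mgen S"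

definition is_crl :: "(z2^'n^'n) set \<Rightarrow> bool" where
  "is_crl W \<longleftrightarrow> finite W \<and> mat 1 \<in> W \<and> (\<forall>a\<in>W. \<forall>b\<in>W. a ** b \<in> W) \<and>
     (\<forall>a\<in>W. lat_aut a) \<and> W = mgen {\<sigma>\<in>W. is_reflection \<sigma>}"

section \<open>Submodules\<close>

definition z2_submodule :: "(z2^'n) set \<Rightarrow> bool" where
  "z2_submodule S \<longleftrightarrow> 0 \<in> S \<and> (\<forall>x\<in>S. \<forall>y\<in>S. x + y \<in> S) \<and> (\<forall>c. \<forall>x\<in>S. c *s x \<in> S)"

text \<open>Saturated submodules S of L correspond bijectively to Q_2-subspaces V of
  Q \<otimes> L, via S = L \<inter> V and V = Q S.\<close>

definition saturated :: "(z2^'n) set \<Rightarrow> bool" where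
  "saturated S \<longleftrightarrow> z2_submodule S \<and> (\<forall>c x. c \<noteq> 0 \<and> c *s x \<in> S \<longrightarrow> x \<in> S)"

section \<open>Reduction mod 2 and the DI(4) lattice\<close>

definition z2_red :: "z2 \<Rightarrow> bit" where
  "z2_red x = (if digits x 1 = 0 then 0 else 1)"

definition mat_red :: "z2^'n^'m \<Rightarrow> bit^'n^'m" where
  "mat_red A = (\<chi> i j. z2_red (A $ i $ j))"

text \<open>The properties of (L_Delta, W_Delta) listed in the context: a rank 3 complete
  reflection lattice with W_Delta = {1,-1} x H, H mapped isomorphically onto
  GL(3,F_2) by reduction mod 2 (i.e. W_Delta acts on L_Delta/2 via the natural
  representation), and all reflections nontrivial mod 2.\<close>

definition DI4_like :: "(z2^3^3) set \<Rightarrow> bool" where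
  "DI4_like W \<longleftrightarrow> is_crl W \<and>
     mat_red ` W = {M :: bit^3^3. det M \<noteq> 0} \<and>
     {A\<in>W. mat_red A = mat 1} = {mat 1, - mat 1} \<and>
     (\<exists>H\<subseteq>W. mat 1 \<in> H \<and> (\<forall>a\<in>H. \<forall>b\<in>H. a ** b \<in> H) \<and> inj_on mat_red H \<and>
        mat_red ` H = {M :: bit^3^3. det M \<noteq> 0}) \<and>
     (\<forall>\<sigma>\<in>W. is_reflection \<sigma> \<longrightarrow> mat_red \<sigma> \<noteq> mat 1)"

section \<open>Product decompositions\<close>

text \<open>(Q \<otimes> L, W) = (V1,W1) x (V2,W2), with S_k = L \<inter> V_k.\<close>

definition rat_decomp ::
  "(z2^'n^'n) set \<Rightarrow> (z2^'n) set \<Rightarrow> (z2^'n) set \<Rightarrow> (z2^'n^'n) set \<Rightarrow> (z2^'n^'n) set \<Rightarrow> bool" where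
  "rat_decomp W S1 S2 W1 W2 \<longleftrightarrow>
     saturated S1 \<and> saturated S2 \<and> S1 \<inter> S2 = {0} \<and>
     (\<forall>x. \<exists>c. c \<noteq> 0 \<and> (\<exists>a\<in>S1. \<exists>b\<in>S2. c *s x = a + b)) \<and>
     W1 \<subseteq> W \<and> W2 \<subseteq> W \<and> mat 1 \<in> W1 \<and> mat 1 \<in> W2 \<and>
     (\<forall>a\<in>W1. \<forall>b\<in>W1. a ** b \<in> W1) \<and> (\<forall>a\<in>W2. \<forall>b\<in>W2. a ** b \<in> W2) \<and>
     W = {a ** b | a b. a \<in> W1 \<and> b \<in> W2} \<and> W1 \<inter> W2 = {mat 1} \<and>
     (\<forall>a\<in>W1. \<forall>b\<in>W2. a ** b = b ** a) \<and>
     (\<forall>w\<in>W1. (\<forall>x\<in>S1. w *v x \<in> S1) \<and> (\<forall>x\<in>S2. w *v x = x)) \<and>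
     (\<forall>w\<in>W2. (\<forall>x\<in>S2. w *v x \<in> S2) \<and> (\<forall>x\<in>S1. w *v x = x))"

text \<open>(V2,W2) is isomorphic to (Q \<otimes> L_Delta, W_Delta): a Q_2-linear isomorphism,
  rescaled by a power of 2 so that it maps L_Delta into L \<inter> V2, intertwining a group
  isomorphism W_Delta \<rightarrow> W2.\<close>

definition rat_iso ::
  "(z2^3^3) set \<Rightarrow> (z2^'n) set \<Rightarrow> (z2^'n^'n) set \<Rightarrow> bool" where
  "rat_iso WD S2 W2 \<longleftrightarrow>
     (\<exists>(F :: z2^3^'n) \<psi>. inj ((*v) F) \<and> range ((*v) F) \<subseteq> S2 \<and>
        (\<forall>x\<in>S2. \<exists>c. c \<noteq> 0 \<and> c *s x \<in> range ((*v) F)) \<and>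
        bij_betw \<psi> WD W2 \<and> (\<forall>a\<in>WD. \<forall>b\<in>WD. \<psi> (a ** b) = \<psi> a ** \<psi> b) \<and>
        (\<forall>u\<in>WD. \<psi> u ** F = F ** u))"

section \<open>Markings\<close>

definition lin_on :: "(z2^'n) set \<Rightarrow> (z2^'n \<Rightarrow> z2) \<Rightarrow> bool" where
  "lin_on S \<beta> \<longleftrightarrow> (\<forall>x\<in>S. \<forall>y\<in>S. \<beta> (x + y) = \<beta> x + \<beta> y) \<and> (\<forall>c. \<forall>x\<in>S. \<beta> (c *s x) = c * \<beta> x)"

text \<open>(b, beta) is a marking pair of sigma on the lattice S.\<close>

definition is_marking_on :: "(z2^'n) set \<Rightarrow> z2^'n^'n \<Rightarrow> z2^'n \<Rightarrow> (z2^'n \<Rightarrow> z2) \<Rightarrow> bool" where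
  "is_marking_on S \<sigma> b \<beta> \<longleftrightarrow> b \<in> S \<and> lin_on S \<beta> \<and> (\<forall>x\<in>S. \<sigma> *v x = x + \<beta> x *s b)"

text \<open>(b,beta) ~ (u b, u^-1 beta) for units u (functionals compared on S).\<close>

definition mark_eq_on :: "(z2^'n) set \<Rightarrow> ((z2^'n) \<times> (z2^'n \<Rightarrow> z2)) \<Rightarrow> ((z2^'n) \<times> (z2^'n \<Rightarrow> z2)) \<Rightarrow> bool" where
  "mark_eq_on S p q \<longleftrightarrow> (\<exists>u. z2_unit u \<and> fst q = u *s fst p \<and> (\<forall>x\<in>S. snd p x = u * snd q x))"

text \<open>m assigns a marking (via a representative) to each reflection in W, compatibly
  with conjugation: m(w sigma w^-1) ~ (w b, beta o w^-1) where (b,beta) = m sigma.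
  The condition sigma' ** w = w ** sigma says sigma' = w sigma w^-1.\<close>

definition marked_on :: "(z2^'n) set \<Rightarrow> (z2^'n^'n) set \<Rightarrow> (z2^'n^'n \<Rightarrow> (z2^'n) \<times> (z2^'n \<Rightarrow> z2)) \<Rightarrow> bool" where
  "marked_on S W m \<longleftrightarrow>
     (\<forall>\<sigma>\<in>W. is_reflection \<sigma> \<longrightarrow> is_marking_on S \<sigma> (fst (m \<sigma>)) (snd (m \<sigma>))) \<and>
     (\<forall>w\<in>W. \<forall>\<sigma>\<in>W. \<forall>\<sigma>'\<in>W. is_reflection \<sigma> \<and> \<sigma>' ** w = w ** \<sigma> \<longrightarrow>
        (\<exists>u. z2_unit u \<and> fst (m \<sigma>') = u *s (w *v fst (m \<sigma>)) \<and>
             (\<forall>x\<in>S. snd (m \<sigma>) x = u * snd (m \<sigma>') (w *v x))))"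

text \<open>Projection of L = S1 + S2 onto S1.\<close>

definition lat_proj1 :: "(z2^'n) set \<Rightarrow> (z2^'n) set \<Rightarrow> z2^'n \<Rightarrow> z2^'n" where
  "lat_proj1 S1 S2 x = (THE a. a \<in> S1 \<and> x - a \<in> S2)"

text \<open>The decomposition L = S1 x L_Delta (via a \<mapsto> a, y \<mapsto> G y; W1 x W_Delta \<rightarrow> W via
  (w1,u) \<mapsto> w1 ** psi u) marks_respected the markings m1 of (S1,W1), m2 of (L_Delta,W_Delta)
  and m of (L,W): the product marking of (sigma,1) is (b, beta o pr1), that of
  (1,tau) is (G b', beta' o G^-1 o pr2).\<close>

definition marks_respected ::
  "(z2^'n) set \<Rightarrow> (z2^'n) set \<Rightarrow> z2^3^'n \<Rightarrow> (z2^3^3 \<Rightarrow> z2^'n^'n) \<Rightarrow> (z2^'n^'n) set \<Rightarrow> (z2^3^3) set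
   \<Rightarrow> (z2^'n^'n \<Rightarrow> (z2^'n) \<times> (z2^'n \<Rightarrow> z2)) \<Rightarrow> (z2^'n^'n \<Rightarrow> (z2^'n) \<times> (z2^'n \<Rightarrow> z2))
   \<Rightarrow> (z2^3^3 \<Rightarrow> (z2^3) \<times> (z2^3 \<Rightarrow> z2)) \<Rightarrow> bool" where
  "marks_respected S1 S2 G \<psi> W1 WD m m1 m2 \<longleftrightarrow>
     (\<forall>\<sigma>\<in>W1. is_reflection \<sigma> \<longrightarrow>
        mark_eq_on UNIV (fst (m1 \<sigma>), (\<lambda>x. snd (m1 \<sigma>) (lat_proj1 S1 S2 x))) (m \<sigma>)) \<and>
     (\<forall>\<tau>\<in>WD. is_reflection \<tau> \<longrightarrow>
        mark_eq_on UNIV (G *v fst (m2 \<tau>), (\<lambda>x. snd (m2 \<tau>) (THE y. G *v y = x - lat_proj1 S1 S2 x))) (m (\<psi> \<tau>)))"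

end

(* Let z be the image of -1 in W_Delta. It acts as +1 on S1 = L \<inter> V1 and as -1 on
   S2 = L \<inter> V2, so x + z x and x - z x lie in S1 and S2, and only the factor 2 in
   2x = (x + z x) + (x - z x) keeps L from being S1 + S2. Rescale the rational isomorphism
   L_Delta -> S2 to a map G that is nonzero mod 2; its kernel mod 2 is a proper
   GL(3,F_2)-invariant subspace of F_2^3, hence zero, so G is onto S2. Writing x - z x = G y,
   every element of W_Delta fixes y mod 2, and as GL(3,F_2) fixes no nonzero vector, y is
   even, which halves the decomposition of 2x. A reflection x + f(x) b moves only the line
   through b, so it lies in W1 or W2, and W1 is generated by its reflections. A marking of W
   restricts to markings of the factors (transported to L_Delta along G), and the product
   condition determines the factor markings up to units. *)

theory Submission
  imports Defs "HOL-Number_Theory.Cong"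
begin

section \<open>2-adic integers\<close>

lemma digits_bounds: "0 \<le> digits a n" "digits a n < 2 ^ n"
  using digits[of a] by auto

lemma digits_Suc_mod: "digits a (Suc n) mod 2 ^ n = digits a n"
  using digits[of a] by auto

lemma digits_0 [simp]: "digits a 0 = 0"
  using digits_bounds[of a 0] by simp

lemma digits_mod_pow: "m \<le> n \<Longrightarrow> digits a n mod 2 ^ m = digits a m"
proof (induction n rule: dec_induct)
  case base
  show ?case by (rule z2_digits_mod)
next
  case (step n)
  have "digits a (Suc n) mod 2 ^ m = digits a (Suc n) mod 2 ^ n mod 2 ^ m"
    using step.hyps by (simp add: mod_mod_cancel le_imp_power_dvd)
  then show ?case by (simp add: digits_Suc_mod step.IH)
qed

lemma digits_1_cases: "digits a 1 = 0 \<or> digits a 1 = 1"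
  using digits_bounds[of a 1] by auto

lemmas digits_arith = plus_z2.rep_eq times_z2.rep_eq uminus_z2.rep_eq zero_z2.rep_eq one_z2.rep_eq

lemma digits_two: "digits (2::z2) n = 2 mod 2 ^ n"
  unfolding one_add_one[symmetric] digits_arith by (simp add: mod_add_eq)

lemma digits_two_mult: "digits (2 * a) (Suc n) = 2 * digits a n"
proof -
  have "digits (2 * a) (Suc n) = (2 * digits a (Suc n)) mod (2 * 2 ^ n)"
    by (simp add: digits_arith digits_two mod_mult_left_eq)
  also have "\<dots> = 2 * digits a n"
    by (metis mult_mod_right digits_Suc_mod)
  finally show ?thesis .
qed

lemma z2_two_mult_eq_0:
  assumes "2 * a = (0::z2)"
  shows "a = 0"
proof (rule z2_eqI)
  fix n
  have "digits a (Suc n) = 0"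
    using assms digits_two_mult[of a "Suc n"] by (simp add: digits_arith)
  then show "digits a n = digits 0 n"
    using digits_Suc_mod[of a n] by (simp add: digits_arith)
qed

lemma z2_even_imp_two_dvd:
  assumes "digits a 1 = 0"
  shows "2 dvd a"
proof -
  have even: "even (digits a (Suc n))" for n
    using digits_mod_pow[of 1 "Suc n" a] assms by (simp add: even_iff_mod_2_eq_zero)
  define h where "h n = digits a (Suc n) div 2" for n
  have digits_a: "digits a (Suc n) = 2 * h n" for n
    using even[of n] by (simp add: h_def)
  have h_ok: "\<forall>n. 0 \<le> h n \<and> h n < 2 ^ n \<and> h (Suc n) mod 2 ^ n = h n"
  proof
    fix n
    have "2 * (h (Suc n) mod 2 ^ n) = (2 * h (Suc n)) mod (2 * 2 ^ n)"
      by (rule mult_mod_right)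
    also have "\<dots> = digits a (Suc (Suc n)) mod 2 ^ Suc n"
      by (simp only: digits_a power_Suc)
    also have "\<dots> = 2 * h n"
      by (metis digits_Suc_mod digits_a)
    finally have "h (Suc n) mod 2 ^ n = h n"
      by simp
    moreover have "0 \<le> h n" "h n < 2 ^ n"
      using digits_bounds[of a "Suc n"] unfolding digits_a by simp_all
    ultimately show "0 \<le> h n \<and> h n < 2 ^ n \<and> h (Suc n) mod 2 ^ n = h n"
      by blast
  qed
  have "a = 2 * Abs_z2 h"
  proof (rule z2_eqI)
    fix n
    have "digits (2 * Abs_z2 h) (Suc n) = digits a (Suc n)"
      using Abs_z2_inverse[of h] h_ok by (simp add: digits_two_mult digits_a)
    then show "digits a n = digits (2 * Abs_z2 h) n"
      by (metis digits_Suc_mod)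
  qed
  then show ?thesis by (rule dvdI)
qed

lemma int_mod_inverse_unique:
  fixes d x y M :: int
  assumes "0 \<le> x" "x < M" "0 \<le> y" "y < M" "[d * x = 1] (mod M)" "[d * y = 1] (mod M)"
  shows "x = y"
proof -
  have "[x * (d * y) = y * (d * x)] (mod M)"
    by (simp add: ac_simps)
  then have "[x = y] (mod M)"
    using assms(5,6) by (metis cong_scalar_left cong_sym cong_trans mult_1_right)
  then show ?thesis
    using assms(1-4) by (simp add: cong_def)
qed

text \<open>The inverse of an odd 2-adic integer is assembled digit by digit from the inverses
  of its residues modulo 2^n, which are compatible by uniqueness.\<close>

lemma z2_odd_imp_unit:
  assumes "digits a 1 = 1"
  shows "z2_unit a"
proof -
  have "\<exists>v. 0 \<le> v \<and> v < 2 ^ n \<and> [digits a n * v = 1] (mod 2 ^ n)" for n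
  proof (cases n)
    case 0
    then show ?thesis by (intro exI[of _ 0]) (simp add: cong_def)
  next
    case (Suc m)
    have "odd (digits a n)"
      using digits_mod_pow[of 1 n a] assms Suc by (simp add: odd_iff_mod_2_eq_one)
    then have "coprime (digits a n) (2 ^ n)"
      by simp
    then obtain x where "[digits a n * x = 1] (mod 2 ^ n)"
      using cong_solve_coprime_int by blast
    then show ?thesis
      by (intro exI[of _ "x mod 2 ^ n"]) (simp add: cong_def mod_mult_right_eq)
  qed
  then obtain v where v: "\<And>n. 0 \<le> v n \<and> v n < 2 ^ n \<and> [digits a n * v n = 1] (mod 2 ^ n)"
    by metis
  have "v (Suc n) mod 2 ^ n = v n" for n
  proof (rule int_mod_inverse_unique)
    have "[digits a (Suc n) * v (Suc n) = 1] (mod 2 ^ Suc n)"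
      using v by blast
    then have "[digits a (Suc n) * v (Suc n) = 1] (mod 2 ^ n)"
      by (rule cong_dvd_modulus) simp
    then show "[digits a n * (v (Suc n) mod 2 ^ n) = 1] (mod 2 ^ n)"
      by (metis cong_def digits_Suc_mod mod_mult_eq)
  qed (use v in auto)
  then have "a * Abs_z2 v = 1"
    using v by (intro z2_eqI) (simp add: Abs_z2_inverse digits_arith cong_def)
  then show ?thesis
    unfolding z2_unit_def by blast
qed

lemma z2_unit_imp_odd:
  assumes "z2_unit a"
  shows "digits a 1 = 1"
proof -
  obtain b where "a * b = 1"
    using assms unfolding z2_unit_def by blast
  then have "digits (a * b) 1 = 1"
    by (simp add: one_z2.rep_eq)
  then have "(digits a 1 * digits b 1) mod 2 = 1"
    by (simp add: times_z2.rep_eq)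
  then show ?thesis
    using digits_1_cases[of a] by auto
qed

lemma z2_unit_iff_odd: "z2_unit a \<longleftrightarrow> digits a 1 = 1"
  using z2_odd_imp_unit z2_unit_imp_odd by blast

lemma z2_unit_nonzero: "z2_unit u \<Longrightarrow> u \<noteq> 0"
  by (auto simp: z2_unit_def)

lemma z2_unit_inverse: "z2_unit u \<Longrightarrow> \<exists>v. z2_unit v \<and> v * u = 1"
  unfolding z2_unit_def by (metis mult.commute)

lemma z2_content_decomposition:
  fixes f :: "'i \<Rightarrow> z2"
  assumes "f i0 \<noteq> 0"
  shows "\<exists>s g. (\<forall>i. f i = 2 ^ s * g i) \<and> (\<exists>i. z2_unit (g i))"
proof -
  obtain N where "digits (f i0) N \<noteq> 0"
    using assms z2_eqI[of "f i0" 0] by (auto simp: digits_arith)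
  then show ?thesis
  proof (induction N arbitrary: f)
    case 0
    then show ?case by simp
  next
    case (Suc N)
    show ?case
    proof (cases "\<exists>i. z2_unit (f i)")
      case True
      then show ?thesis by (intro exI[of _ 0] exI[of _ f]) simp
    next
      case False
      then have "\<forall>i. \<exists>k. f i = 2 * k"
        using digits_1_cases z2_even_imp_two_dvd z2_odd_imp_unit by (metis dvdE)
      then obtain h where h: "\<And>i. f i = 2 * h i"
        by metis
      have "digits (h i0) N \<noteq> 0"
        using Suc.prems digits_two_mult[of "h i0" N] by (simp add: h)
      then obtain s g where "\<forall>i. h i = 2 ^ s * g i" "\<exists>i. z2_unit (g i)"
        using Suc.IH by blast
      then show ?thesis
        by (intro exI[of _ "Suc s"] exI[of _ g]) (simp add: h mult.assoc)
    qed
  qed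
qed

lemma z2_pow2_times_unit: "a \<noteq> 0 \<Longrightarrow> \<exists>s u. z2_unit u \<and> a = 2 ^ s * (u::z2)"
  using z2_content_decomposition[of "\<lambda>_::unit. a"] by auto

instance z2 :: idom
proof
  fix a b :: z2
  assume "a \<noteq> 0" "b \<noteq> 0"
  obtain s u where u: "z2_unit u" "a = 2 ^ s * u"
    using \<open>a \<noteq> 0\<close> z2_pow2_times_unit by blast
  obtain v where v: "v * u = 1"
    using u(1) z2_unit_inverse by blast
  have "2 ^ s * b \<noteq> 0"
    using \<open>b \<noteq> 0\<close> by (induction s) (auto simp: mult.assoc dest: z2_two_mult_eq_0)
  moreover have "v * (a * b) = 2 ^ s * (v * u) * b"
    by (simp add: u(2) ac_simps)
  ultimately show "a * b \<noteq> 0"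
    using v by auto
qed

lemma z2_two_nonzero [simp]: "(2::z2) \<noteq> 0"
proof
  assume "(2::z2) = 0"
  then have "digits (2::z2) 2 = digits 0 2" by simp
  then show False by (simp add: digits_two digits_arith)
qed

section \<open>Reduction modulo 2\<close>

lemma z2_red_add: "z2_red (a + b) = z2_red a + z2_red b"
  using digits_1_cases[of a] digits_1_cases[of b] by (auto simp: z2_red_def plus_z2.rep_eq)

lemma z2_red_mult: "z2_red (a * b) = z2_red a * z2_red b"
  using digits_1_cases[of a] digits_1_cases[of b] by (auto simp: z2_red_def times_z2.rep_eq)

lemma z2_red_0 [simp]: "z2_red 0 = 0"
  by (simp add: z2_red_def zero_z2.rep_eq)

lemma z2_red_2 [simp]: "z2_red 2 = 0"
  by (simp add: z2_red_def digits_two)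

lemma z2_red_sum: "z2_red (sum f A) = (\<Sum>x\<in>A. z2_red (f x))"
  by (induction A rule: infinite_finite_induct) (auto simp: z2_red_add)

lemma z2_red_unit: "z2_unit u \<Longrightarrow> z2_red u = 1"
  by (simp add: z2_red_def z2_unit_iff_odd)

lemma z2_red_eq_0_imp_two_dvd: "z2_red a = 0 \<Longrightarrow> 2 dvd a"
  using digits_1_cases[of a] by (auto simp: z2_red_def intro: z2_even_imp_two_dvd)

definition vec_red :: "z2^'n \<Rightarrow> bit^'n" where
  "vec_red x = (\<chi> i. z2_red (x $ i))"

lemma mat_red_matrix_mult: "mat_red (A ** B) = mat_red A ** mat_red B"
  by (simp add: mat_red_def matrix_matrix_mult_def vec_eq_iff z2_red_sum z2_red_mult)

lemma vec_red_matrix_vector_mult: "vec_red (A *v x) = mat_red A *v vec_red x"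
  by (simp add: mat_red_def vec_red_def matrix_vector_mult_def vec_eq_iff z2_red_sum z2_red_mult)

lemma vec_red_add: "vec_red (x + y) = vec_red x + vec_red y"
  by (simp add: vec_red_def vec_eq_iff z2_red_add)

lemma vec_red_two_smult [simp]: "vec_red (2 *s x) = 0"
  by (simp add: vec_red_def vec_eq_iff z2_red_mult)

lemma vec_red_eq_0_imp: "vec_red y = 0 \<Longrightarrow> \<exists>y'. y = 2 *s y'"
proof -
  assume "vec_red y = 0"
  then have "\<forall>i. \<exists>c. y $ i = 2 * c"
    by (auto simp: vec_red_def vec_eq_iff dest!: z2_red_eq_0_imp_two_dvd)
  then obtain c where "\<And>i. y $ i = 2 * c i"
    by metis
  then have "y = 2 *s (\<chi> i. c i)"
    by (simp add: vec_eq_iff)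
  then show ?thesis ..
qed

section \<open>Matrices over commutative rings\<close>

lemma matrix_vector_mult_smult: "A *v (c *s x) = (c::'a::comm_semiring_1) *s (A *v x)"
  by (simp add: matrix_vector_mult_def vec_eq_iff sum_distrib_left ac_simps)

lemma uminus_matrix_vector_mult: "(- A) *v x = - (A *v (x::'a::comm_ring_1^'n))"
  by (simp add: matrix_vector_mult_def vec_eq_iff sum_negf)

lemma matrix_vector_mult_uminus: "A *v (- x) = - (A *v (x::'a::comm_ring_1^'n))"
  by (simp add: matrix_vector_mult_def vec_eq_iff sum_negf)

lemma vector_smult_lcancel_idom [simp]: "c *s x = c *s y \<longleftrightarrow> (c::'a::idom) = 0 \<or> x = y"
  by (auto simp: vec_eq_iff)

lemma vector_smult_rcancel_idom [simp]: "a *s x = b *s x \<longleftrightarrow> (a::'a::idom) = b \<or> x = 0"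
proof -
  have "a *s x = b *s x \<longleftrightarrow> (a - b) *s x = 0"
    by (metis eq_iff_diff_eq_0 vector_sub_rdistrib)
  then show ?thesis
    by (simp only: vector_mul_eq_0 right_minus_eq)
qed

lemma matrix_vector_mult_axis: "(A *v axis j 1) $ i = A $ i $ j"
  by (simp add: matrix_vector_mult_def axis_def if_distrib cong: if_cong)

lemma matrix_matrix_mult_column: "(A ** B) $ i $ j = (A *v (\<chi> l. B $ l $ j)) $ i"
  by (simp add: matrix_matrix_mult_def matrix_vector_mult_def)

lemma det_zero_row_comm_ring:
  fixes A :: "'a::comm_ring_1^'n^'n"
  assumes "\<And>j. A $ k $ j = 0"
  shows "det A = 0"
proof -
  have "(\<Prod>i\<in>UNIV. A $ i $ p i) = 0" for p
    using assms by (intro prod_zero) auto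
  then show ?thesis
    unfolding det_def by simp
qed

lemma det_diagonal_except_row:
  fixes A :: "'a::comm_ring_1^'n^'n"
  assumes off_diag: "\<And>i j. i \<noteq> k \<Longrightarrow> i \<noteq> j \<Longrightarrow> A $ i $ j = 0"
  shows "det A = (\<Prod>i\<in>UNIV. A $ i $ i)"
proof -
  have "(\<Prod>i\<in>UNIV. A $ i $ p i) = 0" if p: "p permutes UNIV" "p \<noteq> id" for p
  proof -
    obtain i where i: "i \<noteq> k" "p i \<noteq> i"
    proof (rule ccontr)
      assume "\<not> thesis"
      then have fixes_others: "i \<noteq> k \<Longrightarrow> p i = i" for i
        using that by blast
      then have "p k = k"
        using p(1) by (metis permutes_inverses(1))
      then show False
        using p(2) fixes_others by (metis eq_id_iff)
    qed
    then show ?thesis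
      using off_diag[OF i(1), of "p i"] i(2) by (intro prod_zero) auto
  qed
  then have "det A = (\<Sum>p\<in>{id}. of_int (sign p) * (\<Prod>i\<in>UNIV. A $ i $ p i))"
    unfolding det_def by (intro sum.mono_neutral_right) (auto simp: finite_permutations)
  then show ?thesis
    by simp
qed

lemma det_diagonal_except_column:
  fixes A :: "'a::comm_ring_1^'n^'n"
  assumes "\<And>i j. j \<noteq> k \<Longrightarrow> i \<noteq> j \<Longrightarrow> A $ i $ j = 0"
  shows "det A = (\<Prod>i\<in>UNIV. A $ i $ i)"
proof -
  have "det (transpose A) = (\<Prod>i\<in>UNIV. transpose A $ i $ i)"
    by (rule det_diagonal_except_row[of k]) (simp add: transpose_def assms)
  then show ?thesis
    by (simp only: det_transpose) (simp add: transpose_def)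
qed

definition column_replaced_identity :: "'n \<Rightarrow> 'a::comm_ring_1^'n \<Rightarrow> 'a^'n^'n" where
  "column_replaced_identity k x = (\<chi> i j. if j = k then x $ i else if i = j then 1 else 0)"

lemma det_column_replaced_identity: "det (column_replaced_identity k x) = x $ k"
proof -
  have "det (column_replaced_identity k x) = (\<Prod>i\<in>UNIV. column_replaced_identity k x $ i $ i)"
    by (rule det_diagonal_except_column[of k]) (simp add: column_replaced_identity_def)
  also have "\<dots> = (\<Prod>i\<in>UNIV. if i = k then x $ k else 1)"
    by (rule prod.cong) (auto simp: column_replaced_identity_def)
  finally show ?thesis
    by (simp add: prod.If_cases)
qed

lemma det_nonzero_imp_kernel_trivial:
  fixes P :: "'a::idom^'n^'n"
  assumes "det P \<noteq> 0" "P *v x = 0"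
  shows "x = 0"
proof -
  have "x $ k = 0" for k
  proof -
    have "det (P ** column_replaced_identity k x) = 0"
      using assms(2) by (intro det_zero_row_comm_ring[where k = k, of "transpose _", simplified det_transpose])
        (simp add: transpose_def matrix_matrix_mult_column column_replaced_identity_def)
    then show ?thesis
      using assms(1) by (simp add: det_mul det_column_replaced_identity)
  qed
  then show ?thesis
    by (simp add: vec_eq_iff)
qed

lemma det_nonzero_imp_matrix_vector_mult_inj:
  fixes P :: "'a::idom^'n^'n"
  assumes "det P \<noteq> 0" "P *v x = P *v y"
  shows "x = y"
  using det_nonzero_imp_kernel_trivial[OF assms(1), of "x - y"] assms(2)
  by (simp add: matrix_vector_mult_diff_distrib)

section \<open>Reflections as rank one updates\<close>

lemma rank_one_update_functional:
  fixes A :: "'a::idom^'n^'n"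
  assumes "b \<noteq> 0" and update: "\<And>x. A *v x = x + f x *s b"
  shows "f (x + y) = f x + f y" and "f (c *s x) = c * f x"
proof -
  have "f (x + y) *s b = f x *s b + f y *s b"
    using matrix_vector_right_distrib[of A x y] by (simp add: update)
  then show "f (x + y) = f x + f y"
    using \<open>b \<noteq> 0\<close> by (metis vector_sadd_rdistrib vector_smult_rcancel_idom)
  have "f (c *s x) *s b = (c * f x) *s b"
    using matrix_vector_mult_smult[of A c x] by (simp add: update)
  then show "f (c *s x) = c * f x"
    using \<open>b \<noteq> 0\<close> by simp
qed

lemma rank_one_involution_coefficient:
  fixes A :: "'a::idom^'n^'n"
  assumes "b \<noteq> 0" and update: "\<And>x. A *v x = x + f x *s b"
    and involution: "\<And>x. A *v (A *v x) = x" and moved: "A *v x0 \<noteq> x0"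
  shows "f b = -2"
proof -
  note linear = rank_one_update_functional[OF \<open>b \<noteq> 0\<close> update]
  have "x0 = A *v (A *v x0)"
    by (simp add: involution)
  also have "\<dots> = x0 + (f x0 + (f x0 + f x0 * f b)) *s b"
    by (simp add: update linear vec_eq_iff algebra_simps)
  finally have "(f x0 + (f x0 + f x0 * f b)) *s b = 0"
    by (metis add_cancel_left_right)
  then have "f x0 + (f x0 + f x0 * f b) = 0"
    using \<open>b \<noteq> 0\<close> by (metis vector_mul_eq_0)
  then have "f x0 * (2 + f b) = 0"
    by (simp add: algebra_simps)
  moreover have "f x0 \<noteq> 0"
    using moved update[of x0] by auto
  ultimately show ?thesis
    by (simp add: add_eq_0_iff)
qed

lemma diag_refl_matrix_vector_mult:
  "diag_refl i0 *v y = (\<chi> i. if i = i0 then - y $ i else y $ i)"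
proof -
  have "(diag_refl i0 *v y) $ i = (\<Sum>j\<in>UNIV. if i = j then (if i = i0 then - 1 else 1) * y $ j else 0)"
    for i
    unfolding matrix_vector_mult_def diag_refl_def vec_lambda_beta by (rule sum.cong) auto
  then show ?thesis
    by (simp add: vec_eq_iff)
qed

lemma diag_refl_involutive: "diag_refl i0 ** diag_refl i0 = mat 1"
  by (simp add: matrix_eq matrix_vector_mul_assoc[symmetric] diag_refl_matrix_vector_mult vec_eq_iff)

lemma reflection_conjugate_image:
  assumes "P ** \<sigma> = diag_refl i0 ** P"
  shows "P *v (\<sigma> *v x - x) = (- 2 * (P *v x) $ i0) *s axis i0 1"
proof -
  have "P *v (\<sigma> *v x) = diag_refl i0 *v (P *v x)"
    by (simp add: matrix_vector_mul_assoc assms)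
  then show ?thesis
    by (simp add: matrix_vector_mult_diff_distrib diag_refl_matrix_vector_mult vec_eq_iff axis_def)
qed

lemma smult_eq_smult_unit_coordinate:
  fixes v y :: "'a::idom^'n"
  assumes "\<gamma> \<noteq> 0" "\<gamma> *s v = a *s y" "y $ k * w = 1"
  shows "v = (v $ k * w) *s y"
proof -
  have component: "\<gamma> * v $ i = a * y $ i" for i
    using arg_cong[OF assms(2), of "\<lambda>u. u $ i"] by simp
  have "\<gamma> * (v $ k * w * y $ i) = a * (y $ k * w) * y $ i" for i
    using component[of k] by (simp add: ac_simps)
  then have "\<gamma> * (v $ k * w * y $ i) = \<gamma> * v $ i" for i
    by (simp add: assms(3) component)
  then show ?thesis
    using assms(1) by (simp add: vec_eq_iff)
qed

lemma z2_vec_content_decomposition: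
  fixes y :: "z2^'n"
  assumes "y \<noteq> 0"
  shows "\<exists>s y1 k. y = 2 ^ s *s y1 \<and> z2_unit (y1 $ k)"
proof -
  obtain i0 where "y $ i0 \<noteq> 0"
    using assms by (auto simp: vec_eq_iff)
  then obtain s g where "\<forall>i. y $ i = 2 ^ s * g i" "\<exists>i. z2_unit (g i)"
    using z2_content_decomposition[of "\<lambda>i. y $ i"] by blast
  then show ?thesis
    by (intro exI[of _ s] exI[of _ "\<chi> i. g i"]) (auto simp: vec_eq_iff)
qed

text \<open>Divide y by its content; a unit coordinate of the quotient then determines the
  coefficient of g x.\<close>

lemma z2_rank_one_from_scaled:
  fixes g :: "z2^'n \<Rightarrow> z2^'m"
  assumes "\<gamma> \<noteq> 0" "y \<noteq> 0" "\<And>x. \<gamma> *s g x = p x *s y"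
  shows "\<exists>f y1. y1 \<noteq> 0 \<and> (\<forall>x. g x = f x *s y1)"
proof -
  obtain s y1 k where y1: "y = 2 ^ s *s y1" "z2_unit (y1 $ k)"
    using z2_vec_content_decomposition[OF assms(2)] by blast
  obtain w where w: "y1 $ k * w = 1"
    using y1(2) unfolding z2_unit_def by blast
  have "g x = (g x $ k * w) *s y1" for x
    by (rule smult_eq_smult_unit_coordinate[OF assms(1) _ w, where a = "p x * 2 ^ s"])
      (simp add: assms(3) y1(1))
  moreover have "y1 \<noteq> 0"
    using y1(2) z2_unit_nonzero by (auto simp: vec_eq_iff)
  ultimately show ?thesis
    by (intro exI[of _ "\<lambda>x. g x $ k * w"] exI[of _ y1]) auto
qed

lemma reflection_conjugate_involutive:
  assumes "det P \<noteq> 0" and conj: "P ** \<sigma> = diag_refl i0 ** P"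
  shows "\<sigma> *v (\<sigma> *v x) = x"
proof -
  have step: "P *v (\<sigma> *v y) = diag_refl i0 *v (P *v y)" for y
    by (metis matrix_vector_mul_assoc conj)
  have "P *v (\<sigma> *v (\<sigma> *v x)) = diag_refl i0 *v (diag_refl i0 *v (P *v x))"
    by (simp only: step)
  also have "\<dots> = P *v x"
    by (simp only: matrix_vector_mul_assoc matrix_mul_assoc diag_refl_involutive matrix_mul_lid)
  finally show ?thesis
    by (rule det_nonzero_imp_matrix_vector_mult_inj[OF \<open>det P \<noteq> 0\<close>])
qed

lemma reflection_form:
  assumes "is_reflection \<sigma>"
  shows "\<exists>b f. b \<noteq> 0 \<and> (\<forall>x. \<sigma> *v x = x + f x *s b) \<and> f b = -2"
proof -
  obtain P i0 where det_P: "det P \<noteq> 0" and conj: "P ** \<sigma> = diag_refl i0 ** P"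
    using assms unfolding is_reflection_def by blast
  define p where "p x = (P *v x) $ i0" for x
  have image: "P *v (\<sigma> *v x - x) = (- 2 * p x) *s axis i0 1" for x
    unfolding p_def by (rule reflection_conjugate_image[OF conj])
  obtain x0 where x0: "\<sigma> *v x0 \<noteq> x0"
  proof (rule ccontr)
    assume "\<not> thesis"
    then have "\<sigma> *v x = x" for x
      using that by blast
    then have "p x = 0" for x
      using image[of x] by simp
    then have "det P = 0"
      by (intro det_zero_row_comm_ring[where k = i0]) (metis matrix_vector_mult_axis p_def)
    then show False
      using det_P by simp
  qed
  have "p x0 \<noteq> 0"
    using x0 image[of x0] det_nonzero_imp_kernel_trivial[OF det_P] by force
  moreover have "p x0 *s (\<sigma> *v x - x) = p x *s (\<sigma> *v x0 - x0)" for x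
  proof (rule det_nonzero_imp_matrix_vector_mult_inj[OF det_P])
    show "P *v (p x0 *s (\<sigma> *v x - x)) = P *v (p x *s (\<sigma> *v x0 - x0))"
      by (simp only: matrix_vector_mult_smult image) (simp add: ac_simps)
  qed
  ultimately have "\<exists>f b. b \<noteq> 0 \<and> (\<forall>x. \<sigma> *v x - x = f x *s b)"
    using x0 by (intro z2_rank_one_from_scaled[where p = p and y = "\<sigma> *v x0 - x0"]) auto
  then obtain f b where b: "b \<noteq> 0" and "\<And>x. \<sigma> *v x - x = f x *s b"
    by blast
  then have update: "\<And>x. \<sigma> *v x = x + f x *s b"
    by (metis add.commute diff_add_cancel)
  have "f b = -2"
    using rank_one_involution_coefficient[OF b update] reflection_conjugate_involutive[OF det_P conj] x0
    by blast
  then show ?thesis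
    using b update by blast
qed

lemma reflection_moves_vector:
  assumes "is_reflection \<sigma>"
  obtains x where "\<sigma> *v x \<noteq> x"
proof -
  obtain b f where "b \<noteq> 0" "\<And>x. \<sigma> *v x = x + f x *s b" "f b = -2"
    using reflection_form[OF assms] by blast
  then have "\<sigma> *v b \<noteq> b"
    by simp
  then show ?thesis
    using that by blast
qed

lemma linear_functional_expansion:
  fixes f :: "'a::comm_ring_1^'n \<Rightarrow> 'a"
  assumes add: "\<And>x y. f (x + y) = f x + f y" and smult: "\<And>c x. f (c *s x) = c * f x"
  shows "f x = (\<Sum>j\<in>UNIV. x $ j * f (axis j 1))"
proof -
  have "f (sum g A) = (\<Sum>j\<in>A. f (g j))" if "finite A" for g and A :: "'n set"
    using that by (induction A rule: finite_induct) (simp_all add: add smult[of 0 0, simplified])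
  then have "f (\<Sum>j\<in>UNIV. x $ j *s axis j 1) = (\<Sum>j\<in>UNIV. x $ j * f (axis j 1))"
    by (simp add: smult)
  then show ?thesis
    by (simp add: basis_expansion)
qed

text \<open>A change of basis putting the rank one update x + f x b into diagonal form: the k-th
  coordinate is f, the others are the 2 x 2 minors b_k x_i - b_i x_k, which vanish on b.\<close>

lemma rank_one_update_frame:
  fixes f :: "'a::idom^'n \<Rightarrow> 'a"
  assumes add: "\<And>x y. f (x + y) = f x + f y" and smult: "\<And>c x. f (c *s x) = c * f x"
    and "b $ k \<noteq> 0" "f b \<noteq> 0"
  obtains P where "\<And>v. P *v v = (\<chi> i. if i = k then f v else b $ k * v $ i - b $ i * v $ k)"
    and "det P \<noteq> 0"
proof
  define P :: "'a^'n^'n" where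
    "P = (\<chi> i j. if i = k then f (axis j 1) else (if i = j then b $ k else 0) - (if j = k then b $ i else 0))"
  show P: "P *v v = (\<chi> i. if i = k then f v else b $ k * v $ i - b $ i * v $ k)" for v
  proof -
    have "(P *v v) $ i = (if i = k then f v else b $ k * v $ i - b $ i * v $ k)" for i
    proof (cases "i = k")
      case True
      then show ?thesis
        using linear_functional_expansion[OF add smult, of v]
        by (simp add: P_def matrix_vector_mult_def mult.commute)
    next
      case False
      have "(P *v v) $ i = (\<Sum>j\<in>UNIV. (if i = j then b $ k * v $ j else 0) - (if j = k then b $ i * v $ j else 0))"
        unfolding P_def matrix_vector_mult_def vec_lambda_beta using False by (intro sum.cong) auto
      then show ?thesis
        using False by (simp add: sum_subtractf)
    qed
    then show ?thesis
      by (simp add: vec_eq_iff)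
  qed
  let ?C = "column_replaced_identity k b"
  have PC: "(P ** ?C) $ i $ j = (P *v (if j = k then b else axis j 1)) $ i" for i j
    by (simp add: matrix_matrix_mult_column column_replaced_identity_def vec_eq_iff axis_def)
  have "det (P ** ?C) = (\<Prod>i\<in>UNIV. (P ** ?C) $ i $ i)"
    by (rule det_diagonal_except_row[where k = k]) (auto simp: PC P axis_def mult.commute)
  moreover have "(P ** ?C) $ i $ i \<noteq> 0" for i
    using assms(3,4) by (simp add: PC P axis_def)
  ultimately have "det (P ** ?C) \<noteq> 0"
    by simp
  then show "det P \<noteq> 0"
    by (auto simp: det_mul)
qed

lemma reflection_of_form:
  assumes "lat_aut \<sigma>" and "b \<noteq> 0" and update: "\<And>x. \<sigma> *v x = x + f x *s b" and "f b = -2"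
  shows "is_reflection \<sigma>"
proof -
  note linear = rank_one_update_functional[OF \<open>b \<noteq> 0\<close> update]
  obtain k where "b $ k \<noteq> 0"
    using \<open>b \<noteq> 0\<close> by (auto simp: vec_eq_iff)
  moreover have "f b \<noteq> 0"
    using \<open>f b = -2\<close> by simp
  ultimately obtain P where P: "\<And>v. P *v v = (\<chi> i. if i = k then f v else b $ k * v $ i - b $ i * v $ k)"
    and "det P \<noteq> 0"
    using rank_one_update_frame[OF linear] by blast
  have "(P *v (\<sigma> *v x)) $ i = (diag_refl k *v (P *v x)) $ i" for x i
  proof (cases "i = k")
    case True
    have "f x + f x * f b = - f x"
      using \<open>f b = -2\<close> by algebra
    then show ?thesis
      using True by (simp add: P update linear diag_refl_matrix_vector_mult)
  next
    case False
    have "b $ k * (x $ i + f x * b $ i) - b $ i * (x $ k + f x * b $ k) = b $ k * x $ i - b $ i * x $ k"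
      by algebra
    then show ?thesis
      using False by (simp add: P update diag_refl_matrix_vector_mult)
  qed
  then have "P ** \<sigma> = diag_refl k ** P"
    by (simp add: matrix_eq vec_eq_iff matrix_vector_mul_assoc[symmetric])
  then show ?thesis
    unfolding is_reflection_def using \<open>lat_aut \<sigma>\<close> \<open>det P \<noteq> 0\<close> by blast
qed

section \<open>Transvections and GL(n, F_2)\<close>

definition transvection :: "'n \<Rightarrow> 'n \<Rightarrow> 'a::comm_ring_1^'n^'n" where
  "transvection i j = (\<chi> r c. if r = c then 1 else if r = i \<and> c = j then 1 else 0)"

lemma det_transvection:
  assumes "i \<noteq> j"
  shows "det (transvection i j) = 1"
  by (subst det_diagonal_except_row[where k = i]) (auto simp: transvection_def)

lemma transvection_matrix_vector_mult:
  assumes "i \<noteq> j"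
  shows "transvection i j *v v = v + v $ j *s axis i 1"
proof -
  have "(transvection i j *v v) $ r = (\<Sum>c\<in>UNIV. (if c = r then v $ c else 0) + (if r = i \<and> c = j then v $ c else 0))"
    for r
    unfolding transvection_def matrix_vector_mult_def vec_lambda_beta
    using assms by (intro sum.cong) auto
  then show ?thesis
    by (simp add: vec_eq_iff sum.distrib axis_def)
qed

lemma bit_vec_add_self [simp]: "x + x = (0::bit^'n)"
  by (simp add: vec_eq_iff)

lemma exists_other_index:
  assumes "CARD('n) \<ge> 2"
  obtains i :: 'n where "i \<noteq> j"
proof (rule ccontr)
  assume "\<not> thesis"
  then have "UNIV = {j}"
    using that by blast
  then have "CARD('n) = card {j}"
    by (rule arg_cong)
  then show False
    using assms by simp
qed

lemma GL_F2_fixed_vector_eq_0: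
  fixes v :: "bit^'n"
  assumes "CARD('n) \<ge> 2" and fixed: "\<And>M. det M \<noteq> 0 \<Longrightarrow> M *v v = v"
  shows "v = 0"
proof -
  have "v $ j = 0" for j
  proof -
    obtain i where "i \<noteq> j"
      using exists_other_index[OF assms(1)] .
    then have "v + v $ j *s axis i 1 = v"
      using fixed[of "transvection i j"] by (simp add: det_transvection transvection_matrix_vector_mult)
    then have "v $ j *s axis i 1 = 0"
      by (metis add_cancel_left_right)
    then show ?thesis
      by simp
  qed
  then show ?thesis
    by (simp add: vec_eq_iff)
qed

lemma GL_F2_invariant_subgroup_eq_UNIV:
  fixes K :: "(bit^'n) set"
  assumes "CARD('n) \<ge> 2"
    and add: "\<And>x y. x \<in> K \<Longrightarrow> y \<in> K \<Longrightarrow> x + y \<in> K"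
    and invariant: "\<And>M x. det M \<noteq> 0 \<Longrightarrow> x \<in> K \<Longrightarrow> M *v x \<in> K"
    and "v \<in> K" "v \<noteq> 0"
  shows "K = UNIV"
proof -
  have coordinate: "x $ j *s axis i 1 \<in> K" if "x \<in> K" "i \<noteq> j" for x i j
  proof -
    have "transvection i j *v x + x \<in> K"
      using that by (intro add invariant) (simp_all add: det_transvection)
    moreover have "transvection i j *v x + x = x $ j *s axis i 1 + (x + x)"
      by (simp only: transvection_matrix_vector_mult[OF \<open>i \<noteq> j\<close>] ac_simps)
    ultimately show ?thesis
      by simp
  qed
  obtain j where "v $ j = 1"
    using \<open>v \<noteq> 0\<close> by (auto simp: vec_eq_iff)
  obtain i where "i \<noteq> j"
    using exists_other_index[OF assms(1)] .
  have axis_i: "axis i 1 \<in> K"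
    using coordinate[OF \<open>v \<in> K\<close> \<open>i \<noteq> j\<close>] \<open>v $ j = 1\<close> by simp
  have axes: "axis l 1 \<in> K" for l
    using coordinate[OF axis_i, of l i] axis_i by (cases "l = i") auto
  have "0 \<in> K"
    using add[OF axis_i axis_i] by simp
  then have scaled_axes: "c *s axis l 1 \<in> K" for c l
    using axes by (cases c) simp_all
  have "(\<Sum>l\<in>A. w $ l *s axis l 1) \<in> K" if "finite A" for w and A :: "'n set"
    using that by (induction A rule: finite_induct) (simp_all add: \<open>0 \<in> K\<close> add scaled_axes)
  then have "w \<in> K" for w
    using basis_expansion[of w] by (metis finite)
  then show ?thesis
    by blast
qed

section \<open>Saturated sublattices and markings\<close>

lemma saturated_submodule:
  assumes "saturated S"
  shows saturated_zero: "0 \<in> S"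
    and saturated_add: "x \<in> S \<Longrightarrow> y \<in> S \<Longrightarrow> x + y \<in> S"
    and saturated_smult: "x \<in> S \<Longrightarrow> c *s x \<in> S"
    and saturated_diff: "x \<in> S \<Longrightarrow> y \<in> S \<Longrightarrow> x - y \<in> S"
    and saturated_cancel: "c \<noteq> 0 \<Longrightarrow> c *s x \<in> S \<Longrightarrow> x \<in> S"
proof -
  show add: "x \<in> S \<Longrightarrow> y \<in> S \<Longrightarrow> x + y \<in> S" and smult: "x \<in> S \<Longrightarrow> c *s x \<in> S" for x y c
    using assms unfolding saturated_def z2_submodule_def by blast+
  show "0 \<in> S" "c \<noteq> 0 \<Longrightarrow> c *s x \<in> S \<Longrightarrow> x \<in> S"
    using assms unfolding saturated_def z2_submodule_def by blast+
  show "x \<in> S \<Longrightarrow> y \<in> S \<Longrightarrow> x - y \<in> S"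
    using add[of x "(-1) *s y"] smult[of y "-1"] by (simp add: vector_sneg_minus1[symmetric])
qed

lemma marking_in_factor:
  assumes "saturated S" "saturated T"
    and span: "\<And>x. \<exists>c. c \<noteq> 0 \<and> (\<exists>a\<in>S. \<exists>b\<in>T. c *s x = a + b)"
    and "is_reflection \<sigma>" and preserves: "\<And>x. x \<in> S \<Longrightarrow> \<sigma> *v x \<in> S"
    and fixed: "\<And>x. x \<in> T \<Longrightarrow> \<sigma> *v x = x"
    and marking: "is_marking_on UNIV \<sigma> b \<beta>"
  shows "b \<in> S" and "\<And>x. x \<in> T \<Longrightarrow> \<beta> x = 0"
proof -
  have update: "\<sigma> *v x = x + \<beta> x *s b" for x
    using marking unfolding is_marking_on_def by blast
  have add: "\<beta> (x + y) = \<beta> x + \<beta> y" and smult: "\<beta> (c *s x) = c * \<beta> x" for x y c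
    using marking unfolding is_marking_on_def lin_on_def by blast+
  obtain x0 where "\<sigma> *v x0 \<noteq> x0"
    using reflection_moves_vector[OF \<open>is_reflection \<sigma>\<close>] .
  then have "b \<noteq> 0" "\<beta> x0 \<noteq> 0"
    using update[of x0] by auto
  show vanish: "\<beta> x = 0" if "x \<in> T" for x
    using update[of x] fixed[OF that] \<open>b \<noteq> 0\<close> by simp
  obtain c a a' where "c \<noteq> 0" "a \<in> S" "a' \<in> T" "c *s x0 = a + a'"
    using span by blast
  then have "\<beta> a = c * \<beta> x0"
    using add[of a a'] smult[of c x0] vanish[of a'] by simp
  then have "\<beta> a \<noteq> 0"
    using \<open>c \<noteq> 0\<close> \<open>\<beta> x0 \<noteq> 0\<close> by simp
  moreover have "\<beta> a *s b \<in> S"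
    using update[of a] preserves[OF \<open>a \<in> S\<close>] saturated_diff[OF \<open>saturated S\<close> _ \<open>a \<in> S\<close>] by force
  ultimately show "b \<in> S"
    using saturated_cancel[OF \<open>saturated S\<close>] by blast
qed

lemma marked_on_marking:
  "marked_on S W m \<Longrightarrow> \<sigma> \<in> W \<Longrightarrow> is_reflection \<sigma> \<Longrightarrow> is_marking_on S \<sigma> (fst (m \<sigma>)) (snd (m \<sigma>))"
  unfolding marked_on_def by blast

lemma marked_on_conjugate:
  "marked_on S W m \<Longrightarrow> w \<in> W \<Longrightarrow> \<sigma> \<in> W \<Longrightarrow> \<sigma>' \<in> W \<Longrightarrow> is_reflection \<sigma> \<Longrightarrow> \<sigma>' ** w = w ** \<sigma> \<Longrightarrow>
    \<exists>u. z2_unit u \<and> fst (m \<sigma>') = u *s (w *v fst (m \<sigma>)) \<and> (\<forall>x\<in>S. snd (m \<sigma>) x = u * snd (m \<sigma>') (w *v x))"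
  unfolding marked_on_def by blast

lemma mark_eq_on_sym:
  assumes "mark_eq_on S p q"
  shows "mark_eq_on S q p"
proof -
  obtain u where u: "z2_unit u" "fst q = u *s fst p" "\<forall>x\<in>S. snd p x = u * snd q x"
    using assms unfolding mark_eq_on_def by blast
  obtain v where v: "z2_unit v" "v * u = 1"
    using z2_unit_inverse[OF u(1)] by blast
  have "fst p = v *s fst q"
    using u(2) v(2) by simp
  moreover have "snd q x = v * snd p x" if "x \<in> S" for x
    using u(3) v(2) that by (simp add: mult.assoc[symmetric])
  ultimately show ?thesis
    unfolding mark_eq_on_def using v(1) by blast
qed

locale lattice_direct_sum =
  fixes S1 S2 :: "(z2^'n) set"
  assumes summand1_saturated: "saturated S1" and summand2_saturated: "saturated S2"
    and summands_inter: "S1 \<inter> S2 = {0}"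
    and summands_span: "\<And>x. \<exists>a\<in>S1. \<exists>b\<in>S2. x = a + b"
begin

lemma lat_proj1_eqI:
  assumes "a \<in> S1" "x - a \<in> S2"
  shows "lat_proj1 S1 S2 x = a"
  unfolding lat_proj1_def
proof (rule the_equality)
  show "a \<in> S1 \<and> x - a \<in> S2"
    using assms by blast
next
  fix a'
  assume a': "a' \<in> S1 \<and> x - a' \<in> S2"
  have "a' - a \<in> S1"
    using assms(1) a' saturated_diff[OF summand1_saturated] by blast
  moreover have "(x - a) - (x - a') \<in> S2"
    using assms(2) a' saturated_diff[OF summand2_saturated] by blast
  then have "a' - a \<in> S2"
    by (simp add: algebra_simps)
  ultimately have "a' - a \<in> S1 \<inter> S2"
    by blast
  then show "a' = a"
    using summands_inter by simp
qed

lemma lat_proj1_mem: "lat_proj1 S1 S2 x \<in> S1"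
  and diff_lat_proj1_mem: "x - lat_proj1 S1 S2 x \<in> S2"
proof -
  obtain a b where "a \<in> S1" "b \<in> S2" "x = a + b"
    using summands_span by blast
  then have "lat_proj1 S1 S2 x = a"
    by (intro lat_proj1_eqI) simp_all
  then show "lat_proj1 S1 S2 x \<in> S1" "x - lat_proj1 S1 S2 x \<in> S2"
    using \<open>a \<in> S1\<close> \<open>b \<in> S2\<close> \<open>x = a + b\<close> by simp_all
qed

lemma lat_proj1_summand1: "x \<in> S1 \<Longrightarrow> lat_proj1 S1 S2 x = x"
  by (rule lat_proj1_eqI) (simp_all add: saturated_zero[OF summand2_saturated])

lemma lat_proj1_summand2: "x \<in> S2 \<Longrightarrow> lat_proj1 S1 S2 x = 0"
  by (rule lat_proj1_eqI) (simp_all add: saturated_zero[OF summand1_saturated])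

lemma additive_vanishing_on_summand2:
  fixes \<beta> :: "z2^'n \<Rightarrow> z2"
  assumes "\<And>x y. \<beta> (x + y) = \<beta> x + \<beta> y" "\<And>x. x \<in> S2 \<Longrightarrow> \<beta> x = 0"
  shows "\<beta> (lat_proj1 S1 S2 x) = \<beta> x"
  using assms(1)[of "lat_proj1 S1 S2 x" "x - lat_proj1 S1 S2 x"] assms(2)[OF diff_lat_proj1_mem]
  by simp

lemma additive_vanishing_on_summand1:
  fixes \<beta> :: "z2^'n \<Rightarrow> z2"
  assumes "\<And>x y. \<beta> (x + y) = \<beta> x + \<beta> y" "\<And>x. x \<in> S1 \<Longrightarrow> \<beta> x = 0"
  shows "\<beta> (x - lat_proj1 S1 S2 x) = \<beta> x"
  using assms(1)[of "lat_proj1 S1 S2 x" "x - lat_proj1 S1 S2 x"] assms(2)[OF lat_proj1_mem]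
  by simp

end

section \<open>Rational products of reflection lattices\<close>

locale rational_product =
  fixes W :: "(z2^'n^'n) set" and S1 S2 :: "(z2^'n) set" and W1 W2 :: "(z2^'n^'n) set"
  assumes S1_saturated: "saturated S1" and S2_saturated: "saturated S2"
    and S1_inter_S2: "S1 \<inter> S2 = {0}"
    and rational_span: "\<And>x. \<exists>c. c \<noteq> 0 \<and> (\<exists>a\<in>S1. \<exists>b\<in>S2. c *s x = a + b)"
    and W_generated: "W = mgen {\<sigma>\<in>W. is_reflection \<sigma>}"
    and W_product: "W = {a ** b | a b. a \<in> W1 \<and> b \<in> W2}"
    and W1_subset: "W1 \<subseteq> W" and W2_subset: "W2 \<subseteq> W"
    and W1_one: "mat 1 \<in> W1" and W2_one: "mat 1 \<in> W2"
    and W1_mult: "\<And>a b. a \<in> W1 \<Longrightarrow> b \<in> W1 \<Longrightarrow> a ** b \<in> W1"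
    and W2_mult: "\<And>a b. a \<in> W2 \<Longrightarrow> b \<in> W2 \<Longrightarrow> a ** b \<in> W2"
    and W1_W2_commute: "\<And>a b. a \<in> W1 \<Longrightarrow> b \<in> W2 \<Longrightarrow> a ** b = b ** a"
    and W1_preserves_S1: "\<And>w x. w \<in> W1 \<Longrightarrow> x \<in> S1 \<Longrightarrow> w *v x \<in> S1"
    and W1_fixes_S2: "\<And>w x. w \<in> W1 \<Longrightarrow> x \<in> S2 \<Longrightarrow> w *v x = x"
    and W2_preserves_S2: "\<And>w x. w \<in> W2 \<Longrightarrow> x \<in> S2 \<Longrightarrow> w *v x \<in> S2"
    and W2_fixes_S1: "\<And>w x. w \<in> W2 \<Longrightarrow> x \<in> S1 \<Longrightarrow> w *v x = x"
begin

lemma rational_span_swap: "\<exists>c. c \<noteq> 0 \<and> (\<exists>a\<in>S2. \<exists>b\<in>S1. c *s x = a + b)"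
  using rational_span[of x] by (metis add.commute)

lemma matrix_eq_on_factors:
  assumes "\<And>x. x \<in> S1 \<Longrightarrow> A *v x = B *v x" "\<And>x. x \<in> S2 \<Longrightarrow> A *v x = B *v x"
  shows "A = B"
proof (subst matrix_eq, intro allI)
  fix x
  obtain c a b where "c \<noteq> 0" "a \<in> S1" "b \<in> S2" "c *s x = a + b"
    using rational_span by blast
  then have "c *s (A *v x) = c *s (B *v x)"
    using assms by (simp add: matrix_vector_mult_smult[symmetric] matrix_vector_right_distrib)
  then show "A *v x = B *v x"
    using \<open>c \<noteq> 0\<close> by simp
qed

lemma W1_moves_S1:
  assumes "w \<in> W1" "w \<noteq> mat 1"
  obtains x where "x \<in> S1" "w *v x \<noteq> x"
  using assms matrix_eq_on_factors[of w "mat 1"] W1_fixes_S2 by auto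

lemma W2_moves_S2:
  assumes "w \<in> W2" "w \<noteq> mat 1"
  obtains x where "x \<in> S2" "w *v x \<noteq> x"
  using assms matrix_eq_on_factors[of w "mat 1"] W2_fixes_S1 by auto

lemma W1_factor_unique:
  assumes "a \<in> W1" "a' \<in> W1" "b \<in> W2" "b' \<in> W2" "a ** b = a' ** b'"
  shows "a = a'"
proof (rule matrix_eq_on_factors)
  fix x
  assume "x \<in> S1"
  then have "a *v x = (a ** b) *v x" and "a' *v x = (a' ** b') *v x"
    using assms(3,4) W2_fixes_S1 by (simp_all flip: matrix_vector_mul_assoc)
  then show "a *v x = a' *v x"
    using assms(5) by simp
next
  fix x
  assume "x \<in> S2"
  then show "a *v x = a' *v x"
    using assms(1,2) W1_fixes_S2 by simp
qed

text \<open>A reflection moves only a rank one part of the lattice, so it cannot move both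
  factors.\<close>

lemma reflection_in_factor:
  assumes "\<sigma> \<in> W" "is_reflection \<sigma>"
  shows "\<sigma> \<in> W1 \<or> \<sigma> \<in> W2"
proof (rule ccontr)
  assume not_in: "\<not> (\<sigma> \<in> W1 \<or> \<sigma> \<in> W2)"
  obtain a b where ab: "a \<in> W1" "b \<in> W2" "\<sigma> = a ** b"
    using assms(1) W_product by blast
  then have "a \<noteq> mat 1" "b \<noteq> mat 1"
    using not_in by auto
  obtain x1 where x1: "x1 \<in> S1" "a *v x1 \<noteq> x1"
    using W1_moves_S1[OF ab(1) \<open>a \<noteq> mat 1\<close>] .
  obtain x2 where x2: "x2 \<in> S2" "b *v x2 \<noteq> x2"
    using W2_moves_S2[OF ab(2) \<open>b \<noteq> mat 1\<close>] .
  obtain v f where update: "\<And>x. \<sigma> *v x = x + f x *s v"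
    using reflection_form[OF assms(2)] by blast
  have acts: "\<sigma> *v x1 = a *v x1" "\<sigma> *v x2 = b *v x2"
    using ab x1(1) x2(1) W2_fixes_S1 W1_fixes_S2 W2_preserves_S2
    by (simp_all flip: matrix_vector_mul_assoc)
  have "f x1 *s v = \<sigma> *v x1 - x1" "f x2 *s v = \<sigma> *v x2 - x2"
    by (simp_all add: update)
  then have moved: "f x1 *s v = a *v x1 - x1" "f x2 *s v = b *v x2 - x2"
    by (simp_all only: acts)
  have "f x2 *s (f x1 *s v) \<in> S1"
    unfolding moved using x1(1) ab(1)
    by (intro saturated_smult[OF S1_saturated] saturated_diff[OF S1_saturated] W1_preserves_S1)
  moreover have "f x1 *s (f x2 *s v) \<in> S2"
    unfolding moved using x2(1) ab(2)
    by (intro saturated_smult[OF S2_saturated] saturated_diff[OF S2_saturated] W2_preserves_S2)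
  moreover have "f x2 *s (f x1 *s v) = f x1 *s (f x2 *s v)"
    by (simp add: mult.commute)
  ultimately have "f x2 *s (f x1 *s v) \<in> S1 \<inter> S2"
    by (metis IntI)
  moreover have "f x1 *s v \<noteq> 0" "f x2 *s v \<noteq> 0"
    using moved x1(2) x2(2) by simp_all
  ultimately show False
    using S1_inter_S2 by simp
qed

lemma mgen_subset_W1:
  assumes "R \<subseteq> W1"
  shows "mgen R \<subseteq> W1"
proof
  fix x
  assume "x \<in> mgen R"
  then show "x \<in> W1"
    by (induction rule: mgen.induct) (use assms in \<open>auto intro: W1_one W1_mult\<close>)
qed

lemma reflection_generated_split:
  assumes "w \<in> mgen {\<sigma>\<in>W. is_reflection \<sigma>}"
  shows "\<exists>g1\<in>mgen {\<sigma>\<in>W1. is_reflection \<sigma>}. \<exists>g2\<in>W2. w = g1 ** g2"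
  using assms
proof (induction rule: mgen.induct)
  case mgen_one
  have "mat 1 = mat 1 ** (mat 1 :: z2^'n^'n)"
    by simp
  then show ?case
    using W2_one mgen.mgen_one by blast
next
  case (mgen_mult a b)
  let ?R1 = "{\<sigma>\<in>W1. is_reflection \<sigma>}"
  obtain g1 g2 where g: "g1 \<in> mgen ?R1" "g2 \<in> W2" "b = g1 ** g2"
    using mgen_mult.IH by blast
  have "g1 \<in> W1"
    using g(1) mgen_subset_W1[of ?R1] by blast
  from mgen_mult.hyps(1) reflection_in_factor consider "a \<in> ?R1" | "a \<in> W2"
    by blast
  then show ?case
  proof cases
    case 1
    have "a ** b = (a ** g1) ** g2"
      by (simp add: g(3) matrix_mul_assoc)
    moreover have "a ** g1 \<in> mgen ?R1"
      using 1 g(1) by (rule mgen.mgen_mult)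
    ultimately show ?thesis
      using g(2) by blast
  next
    case 2
    have "a ** b = (g1 ** a) ** g2"
      by (simp add: g(3) matrix_mul_assoc W1_W2_commute[OF \<open>g1 \<in> W1\<close> 2])
    also have "\<dots> = g1 ** (a ** g2)"
      by (simp add: matrix_mul_assoc)
    finally have "a ** b = g1 ** (a ** g2)" .
    moreover have "a ** g2 \<in> W2"
      using 2 g(2) by (rule W2_mult)
    ultimately show ?thesis
      using g(1) by blast
  qed
qed

lemma W1_generated: "W1 = mgen {\<sigma>\<in>W1. is_reflection \<sigma>}"
proof
  let ?R1 = "{\<sigma>\<in>W1. is_reflection \<sigma>}"
  show "mgen ?R1 \<subseteq> W1"
    by (rule mgen_subset_W1) blast
  show "W1 \<subseteq> mgen ?R1"
  proof
    fix w
    assume "w \<in> W1"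
    then have "w \<in> mgen {\<sigma>\<in>W. is_reflection \<sigma>}"
      using W1_subset by (auto simp only: W_generated[symmetric])
    then obtain g1 g2 where g: "g1 \<in> mgen ?R1" "g2 \<in> W2" "w = g1 ** g2"
      using reflection_generated_split by blast
    have "g1 ** g2 = w ** mat 1"
      using g(3) by simp
    moreover have "g1 \<in> W1"
      using g(1) mgen_subset_W1[of ?R1] by blast
    ultimately have "g1 = w"
      using W1_factor_unique g(2) \<open>w \<in> W1\<close> W2_one by blast
    then show "w \<in> mgen ?R1"
      using g(1) by simp
  qed
qed

lemma marked_on_W1:
  assumes "marked_on UNIV W m"
  shows "marked_on S1 W1 m"
  unfolding marked_on_def
proof (intro conjI ballI impI)
  fix \<sigma>
  assume "\<sigma> \<in> W1" "is_reflection \<sigma>"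
  then have marking: "is_marking_on UNIV \<sigma> (fst (m \<sigma>)) (snd (m \<sigma>))"
    using marked_on_marking[OF assms] W1_subset by blast
  have "fst (m \<sigma>) \<in> S1"
    by (rule marking_in_factor(1)[OF S1_saturated S2_saturated rational_span \<open>is_reflection \<sigma>\<close> _ _ marking])
      (use W1_preserves_S1 W1_fixes_S2 \<open>\<sigma> \<in> W1\<close> in auto)
  then show "is_marking_on S1 \<sigma> (fst (m \<sigma>)) (snd (m \<sigma>))"
    using marking unfolding is_marking_on_def lin_on_def by blast
next
  fix w \<sigma> \<sigma>'
  assume "w \<in> W1" "\<sigma> \<in> W1" "\<sigma>' \<in> W1" and conj: "is_reflection \<sigma> \<and> \<sigma>' ** w = w ** \<sigma>"
  then have "w \<in> W" "\<sigma> \<in> W" "\<sigma>' \<in> W"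
    using W1_subset by blast+
  then show "\<exists>u. z2_unit u \<and> fst (m \<sigma>') = u *s (w *v fst (m \<sigma>)) \<and>
      (\<forall>x\<in>S1. snd (m \<sigma>) x = u * snd (m \<sigma>') (w *v x))"
    using marked_on_conjugate[OF assms \<open>w \<in> W\<close> \<open>\<sigma> \<in> W\<close> \<open>\<sigma>' \<in> W\<close>] conj by blast
qed

end

section \<open>The DI(4) factor is a lattice summand\<close>

lemma z2_matrix_content_decomposition:
  fixes F :: "z2^'m^'n"
  assumes "F \<noteq> 0"
  obtains s G where "\<And>y. F *v y = 2 ^ s *s (G *v y)" and "mat_red G \<noteq> 0"
proof -
  obtain i j where "F $ i $ j \<noteq> 0"
    using assms by (auto simp: vec_eq_iff)
  then obtain s g where g: "\<forall>p. F $ fst p $ snd p = 2 ^ s * g p" and "\<exists>p. z2_unit (g p)"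
    using z2_content_decomposition[of "\<lambda>p. F $ fst p $ snd p" "(i, j)"] by auto
  then obtain p where "z2_unit (g p)"
    by blast
  define G :: "z2^'m^'n" where "G = (\<chi> i j. g (i, j))"
  have "F *v y = 2 ^ s *s (G *v y)" for y
    using g by (simp add: G_def matrix_vector_mult_def vec_eq_iff sum_distrib_left mult.assoc)
  moreover have "mat_red G $ fst p $ snd p = 1"
    using \<open>z2_unit (g p)\<close> by (simp add: mat_red_def G_def z2_red_unit)
  then have "mat_red G \<noteq> 0"
    by auto
  ultimately show ?thesis
    using that by blast
qed

text \<open>G is F divided by the largest power of 2 dividing all its entries.\<close>

lemma rat_iso_primitive:
  assumes "saturated S" and inj: "inj ((*v) F)" and range: "range ((*v) F) \<subseteq> S"
    and onto: "\<forall>x\<in>S. \<exists>c. c \<noteq> 0 \<and> c *s x \<in> range ((*v) F)"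
    and intertwines: "\<forall>u\<in>U. \<psi> u ** F = F ** u"
  obtains G where "inj ((*v) G)" "\<And>y. G *v y \<in> S"
    "\<And>x. x \<in> S \<Longrightarrow> \<exists>c. c \<noteq> 0 \<and> c *s x \<in> range ((*v) G)"
    "\<And>u. u \<in> U \<Longrightarrow> \<psi> u ** G = G ** u" "mat_red G \<noteq> 0"
proof -
  have "F \<noteq> 0"
    using inj injD[of "(*v) F" "axis undefined 1" 0] by auto
  then obtain s G where FG: "\<And>y. F *v y = 2 ^ s *s (G *v y)" and "mat_red G \<noteq> 0"
    using z2_matrix_content_decomposition by blast
  have "inj ((*v) G)"
    using inj by (auto simp: inj_def FG)
  moreover have "G *v y \<in> S" for y
    using range FG saturated_cancel[OF \<open>saturated S\<close>, of "2 ^ s"] by (metis rangeI subsetD power_not_zero z2_two_nonzero)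
  moreover have "\<exists>c. c \<noteq> 0 \<and> c *s x \<in> range ((*v) G)" if "x \<in> S" for x
  proof -
    obtain c y where "c \<noteq> 0" "c *s x = F *v y"
      using onto \<open>x \<in> S\<close> by blast
    then show ?thesis
      by (intro exI[of _ c]) (auto simp: FG matrix_vector_mult_smult[symmetric])
  qed
  moreover have "\<psi> u ** G = G ** u" if "u \<in> U" for u
  proof (subst matrix_eq, intro allI)
    fix y
    have "2 ^ s *s ((\<psi> u ** G) *v y) = \<psi> u *v (F *v y)"
      by (simp add: FG matrix_vector_mult_smult flip: matrix_vector_mul_assoc)
    also have "\<dots> = (F ** u) *v y"
      using intertwines \<open>u \<in> U\<close> by (simp add: matrix_vector_mul_assoc)
    also have "\<dots> = 2 ^ s *s ((G ** u) *v y)"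
      by (simp add: FG flip: matrix_vector_mul_assoc)
    finally show "(\<psi> u ** G) *v y = (G ** u) *v y"
      by simp
  qed
  ultimately show ?thesis
    using that \<open>mat_red G \<noteq> 0\<close> by blast
qed

locale DI4_factor = rational_product W S1 S2 W1 W2
  for W :: "(z2^'n^'n) set" and S1 S2 W1 W2 +
  fixes WD :: "(z2^3^3) set" and G :: "z2^3^'n" and \<psi> :: "z2^3^3 \<Rightarrow> z2^'n^'n"
  assumes W_automorphisms: "\<And>w. w \<in> W \<Longrightarrow> lat_aut w"
    and WD_mod_2: "mat_red ` WD = {M. det M \<noteq> 0}"
    and WD_minus_one: "- mat 1 \<in> WD"
    and \<psi>_maps: "\<And>u. u \<in> WD \<Longrightarrow> \<psi> u \<in> W2"
    and \<psi>_mult: "\<And>a b. a \<in> WD \<Longrightarrow> b \<in> WD \<Longrightarrow> \<psi> (a ** b) = \<psi> a ** \<psi> b"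
    and G_inj: "inj ((*v) G)"
    and G_mem: "\<And>y. G *v y \<in> S2"
    and G_rationally_onto: "\<And>x. x \<in> S2 \<Longrightarrow> \<exists>c. c \<noteq> 0 \<and> c *s x \<in> range ((*v) G)"
    and G_intertwines: "\<And>u. u \<in> WD \<Longrightarrow> \<psi> u ** G = G ** u"
    and G_mod_2_nonzero: "mat_red G \<noteq> 0"
begin

lemma G_intertwines_vec: "u \<in> WD \<Longrightarrow> \<psi> u *v (G *v y) = G *v (u *v y)"
  by (simp add: matrix_vector_mul_assoc G_intertwines)

lemma G_eq_iff [simp]: "G *v y = G *v y' \<longleftrightarrow> y = y'"
  using G_inj by (auto dest: injD)

text \<open>The kernel of G modulo 2 is a W_Delta-invariant, hence GL(3,F_2)-invariant, subgroup
  of F_2^3 which is not everything; by irreducibility it is zero.\<close>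

lemma G_mod_2_kernel:
  assumes "mat_red G *v vec_red y = 0"
  shows "vec_red y = 0"
proof (rule ccontr)
  assume "vec_red y \<noteq> 0"
  let ?K = "{v. mat_red G *v v = 0}"
  have "mat_red G *v (M *v v) = 0" if "det M \<noteq> 0" "mat_red G *v v = 0" for M v
  proof -
    obtain u where "u \<in> WD" "M = mat_red u"
      using \<open>det M \<noteq> 0\<close> WD_mod_2 by (metis (mono_tags) imageE mem_Collect_eq)
    then have "mat_red G ** M = mat_red (\<psi> u) ** mat_red G"
      by (simp add: G_intertwines flip: mat_red_matrix_mult)
    then have "mat_red G *v (M *v v) = mat_red (\<psi> u) *v (mat_red G *v v)"
      by (simp add: matrix_vector_mul_assoc)
    then show ?thesis
      using that(2) by simp
  qed
  then have "?K = UNIV"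
    using assms \<open>vec_red y \<noteq> 0\<close>
    by (intro GL_F2_invariant_subgroup_eq_UNIV[where v = "vec_red y"]) (auto simp: matrix_vector_right_distrib)
  then have "mat_red G *v axis j 1 = 0" for j
    by blast
  then have "mat_red G $ i $ j = 0" for i j
    by (metis matrix_vector_mult_axis zero_index)
  then show False
    using G_mod_2_nonzero by (simp add: vec_eq_iff)
qed

lemma G_halve:
  assumes "2 *s x = G *v y"
  shows "x \<in> range ((*v) G)"
proof -
  have "mat_red G *v vec_red y = vec_red (2 *s x)"
    by (simp only: assms vec_red_matrix_vector_mult)
  then have "mat_red G *v vec_red y = 0"
    by simp
  then obtain y' where "y = 2 *s y'"
    using G_mod_2_kernel vec_red_eq_0_imp by blast
  then have "x = G *v y'"
    using assms by (simp add: matrix_vector_mult_smult)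
  then show ?thesis
    by blast
qed

lemma G_divide_pow2: "2 ^ s *s x = G *v y \<Longrightarrow> x \<in> range ((*v) G)"
proof (induction s arbitrary: x y)
  case 0
  then show ?case
    by auto
next
  case (Suc s)
  then have "2 *s (2 ^ s *s x) = G *v y"
    by simp
  then obtain y' where "2 ^ s *s x = G *v y'"
    using G_halve by blast
  then show ?case
    by (rule Suc.IH)
qed

lemma G_onto: "x \<in> S2 \<Longrightarrow> x \<in> range ((*v) G)"
proof -
  assume "x \<in> S2"
  then obtain c y where "c \<noteq> 0" "c *s x = G *v y"
    using G_rationally_onto by blast
  then obtain s u where "z2_unit u" "c = 2 ^ s * u"
    using z2_pow2_times_unit by blast
  then obtain v where "v * u = 1"
    using z2_unit_inverse by blast
  then have "2 ^ s *s x = v *s (c *s x)"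
    by (simp add: \<open>c = 2 ^ s * u\<close> ac_simps)
  also have "\<dots> = G *v (v *s y)"
    by (simp add: \<open>c *s x = G *v y\<close> matrix_vector_mult_smult)
  finally show ?thesis
    by (rule G_divide_pow2)
qed

lemma G_bij: "bij_betw ((*v) G) UNIV S2"
  unfolding bij_betw_def using G_inj G_mem G_onto by blast


lemma minus_one_on_S1: "x \<in> S1 \<Longrightarrow> \<psi> (- mat 1) *v x = x"
  using W2_fixes_S1 \<psi>_maps[OF WD_minus_one] by blast

lemma minus_one_on_S2: "x \<in> S2 \<Longrightarrow> \<psi> (- mat 1) *v x = - x"
  using G_onto G_intertwines_vec[OF WD_minus_one]
  by (auto simp: uminus_matrix_vector_mult matrix_vector_mult_uminus)

lemma minus_one_parts:
  shows "x + \<psi> (- mat 1) *v x \<in> S1" and "x - \<psi> (- mat 1) *v x \<in> S2"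
proof -
  obtain c a b where "c \<noteq> 0" "a \<in> S1" "b \<in> S2" "c *s x = a + b"
    using rational_span by blast
  then have "c *s (\<psi> (- mat 1) *v x) = a - b"
    using minus_one_on_S1 minus_one_on_S2
    by (simp add: matrix_vector_mult_smult[symmetric] matrix_vector_right_distrib)
  then have plus: "c *s (x + \<psi> (- mat 1) *v x) = a + a"
    and minus: "c *s (x - \<psi> (- mat 1) *v x) = b + b"
    using \<open>c *s x = a + b\<close> by simp_all
  have "c *s (x + \<psi> (- mat 1) *v x) \<in> S1"
    unfolding plus using \<open>a \<in> S1\<close> by (intro saturated_add[OF S1_saturated])
  then show "x + \<psi> (- mat 1) *v x \<in> S1"
    by (rule saturated_cancel[OF S1_saturated \<open>c \<noteq> 0\<close>])
  have "c *s (x - \<psi> (- mat 1) *v x) \<in> S2"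
    unfolding minus using \<open>b \<in> S2\<close> by (intro saturated_add[OF S2_saturated])
  then show "x - \<psi> (- mat 1) *v x \<in> S2"
    by (rule saturated_cancel[OF S2_saturated \<open>c \<noteq> 0\<close>])
qed

lemma coordinate_fixed_mod_2:
  assumes y: "x - \<psi> (- mat 1) *v x = G *v y" and "u \<in> WD"
  shows "mat_red u *v vec_red y = vec_red y"
proof -
  let ?a = "x + \<psi> (- mat 1) *v x"
  have two_x: "2 *s x = ?a + G *v y"
    using y by (simp add: vec_eq_iff algebra_simps)
  have "\<psi> u *v ?a = ?a"
    using W2_fixes_S1 \<psi>_maps[OF \<open>u \<in> WD\<close>] minus_one_parts(1) by blast
  then have "\<psi> u *v (2 *s x) = ?a + G *v (u *v y)"
    unfolding two_x by (simp add: matrix_vector_right_distrib G_intertwines_vec[OF \<open>u \<in> WD\<close>])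
  then have "2 *s (\<psi> u *v x - x) = G *v (u *v y - y)"
    by (simp add: matrix_vector_mult_smult[symmetric] two_x matrix_vector_mult_diff_distrib)
  moreover have "2 *s (\<psi> u *v x - x) \<in> S2"
    unfolding calculation by (rule G_mem)
  then have "\<psi> u *v x - x \<in> S2"
    by (rule saturated_cancel[OF S2_saturated z2_two_nonzero])
  then obtain y' where "\<psi> u *v x - x = G *v y'"
    using G_onto by blast
  ultimately have "u *v y = y + 2 *s y'"
    by (simp add: matrix_vector_mult_smult[symmetric] eq_diff_eq add.commute)
  then show ?thesis
    by (simp add: vec_red_add flip: vec_red_matrix_vector_mult)
qed

lemma lattice_decomposition: "\<exists>a\<in>S1. \<exists>b\<in>S2. x = a + b"
proof -
  have "x - \<psi> (- mat 1) *v x \<in> range ((*v) G)"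
    by (rule G_onto[OF minus_one_parts(2)])
  then obtain y where y: "x - \<psi> (- mat 1) *v x = G *v y"
    by blast
  have "M *v vec_red y = vec_red y" if "det M \<noteq> 0" for M
  proof -
    have "M \<in> mat_red ` WD"
      using that WD_mod_2 by simp
    then show ?thesis
      using coordinate_fixed_mod_2[OF y] by blast
  qed
  then have "vec_red y = 0"
    by (intro GL_F2_fixed_vector_eq_0) simp_all
  then obtain y' where "y = 2 *s y'"
    using vec_red_eq_0_imp by blast
  then have "x - \<psi> (- mat 1) *v x = 2 *s (G *v y')"
    by (simp only: y matrix_vector_mult_smult)
  have "x + \<psi> (- mat 1) *v x = 2 *s x - (x - \<psi> (- mat 1) *v x)"
    by (simp add: vec_eq_iff algebra_simps)
  also have "\<dots> = 2 *s (x - G *v y')"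
    by (simp only: \<open>x - \<psi> (- mat 1) *v x = 2 *s (G *v y')\<close> vector_ssub_ldistrib)
  finally have "2 *s (x - G *v y') \<in> S1"
    using minus_one_parts(1)[of x] by (simp only:)
  then have "x - G *v y' \<in> S1"
    by (rule saturated_cancel[OF S1_saturated z2_two_nonzero])
  then show ?thesis
    using G_mem[of y'] by (intro bexI[of _ "x - G *v y'"] bexI[of _ "G *v y'"]) simp_all
qed

end

sublocale DI4_factor \<subseteq> lattice_direct_sum S1 S2
  using S1_saturated S2_saturated S1_inter_S2 lattice_decomposition by unfold_locales

context DI4_factor
begin

definition factor2_coordinate :: "z2^'n \<Rightarrow> z2^3" where
  "factor2_coordinate x = (THE y. G *v y = x - lat_proj1 S1 S2 x)"

lemma G_factor2_coordinate: "G *v factor2_coordinate x = x - lat_proj1 S1 S2 x"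
proof -
  obtain y where y: "G *v y = x - lat_proj1 S1 S2 x"
    using G_onto[OF diff_lat_proj1_mem] by (metis rangeE)
  have "factor2_coordinate x = y"
    unfolding factor2_coordinate_def
  proof (rule the_equality)
    fix y'
    assume "G *v y' = x - lat_proj1 S1 S2 x"
    then show "y' = y"
      using y G_eq_iff by metis
  qed (rule y)
  then show ?thesis
    using y by simp
qed

lemma factor2_coordinate_G [simp]: "factor2_coordinate (G *v y) = y"
  using G_factor2_coordinate[of "G *v y"] lat_proj1_summand2[OF G_mem] by simp

lemma lattice_split: "x = lat_proj1 S1 S2 x + G *v factor2_coordinate x"
  by (simp add: G_factor2_coordinate)

lemma G_factor2_coordinate_S2: "x \<in> S2 \<Longrightarrow> G *v factor2_coordinate x = x"
  by (simp add: G_factor2_coordinate lat_proj1_summand2)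

lemma \<psi>_reflection:
  assumes "\<tau> \<in> WD" "is_reflection \<tau>"
  shows "is_reflection (\<psi> \<tau>)"
proof -
  obtain b f where "b \<noteq> 0" and update: "\<And>y. \<tau> *v y = y + f y *s b" and "f b = -2"
    using reflection_form[OF assms(2)] by blast
  have "lat_aut (\<psi> \<tau>)"
    using W_automorphisms W2_subset \<psi>_maps[OF assms(1)] by blast
  moreover have "G *v b \<noteq> 0"
    using \<open>b \<noteq> 0\<close> G_eq_iff[of b 0] by simp
  moreover have "\<psi> \<tau> *v x = x + f (factor2_coordinate x) *s (G *v b)" for x
  proof -
    have "\<psi> \<tau> *v lat_proj1 S1 S2 x = lat_proj1 S1 S2 x"
      using W2_fixes_S1 \<psi>_maps[OF assms(1)] lat_proj1_mem by blast
    then have "\<psi> \<tau> *v x = lat_proj1 S1 S2 x + G *v (\<tau> *v factor2_coordinate x)"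
      by (subst lattice_split) (simp add: matrix_vector_right_distrib G_intertwines_vec[OF assms(1)])
    then show ?thesis
      by (subst (2) lattice_split) (simp add: update matrix_vector_right_distrib matrix_vector_mult_smult add.assoc)
  qed
  moreover have "f (factor2_coordinate (G *v b)) = -2"
    using \<open>f b = -2\<close> by simp
  ultimately show ?thesis
    by (rule reflection_of_form)
qed


section \<open>Markings of the factors\<close>

lemma marking_of_\<psi>_reflection:
  assumes "marked_on UNIV W m" "\<tau> \<in> WD" "is_reflection \<tau>"
  shows "is_marking_on UNIV (\<psi> \<tau>) (fst (m (\<psi> \<tau>))) (snd (m (\<psi> \<tau>)))"
    and "fst (m (\<psi> \<tau>)) \<in> S2" and "\<And>x. x \<in> S1 \<Longrightarrow> snd (m (\<psi> \<tau>)) x = 0"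
proof -
  show marking: "is_marking_on UNIV (\<psi> \<tau>) (fst (m (\<psi> \<tau>))) (snd (m (\<psi> \<tau>)))"
    using marked_on_marking[OF assms(1)] \<psi>_maps[OF assms(2)] W2_subset \<psi>_reflection[OF assms(2,3)]
    by blast
  show "fst (m (\<psi> \<tau>)) \<in> S2" "\<And>x. x \<in> S1 \<Longrightarrow> snd (m (\<psi> \<tau>)) x = 0"
    using marking_in_factor[OF S2_saturated S1_saturated rational_span_swap \<psi>_reflection[OF assms(2,3)]
        _ _ marking] W2_preserves_S2 W2_fixes_S1 \<psi>_maps[OF assms(2)] by blast+
qed

definition DI4_marking ::
  "(z2^'n^'n \<Rightarrow> (z2^'n) \<times> (z2^'n \<Rightarrow> z2)) \<Rightarrow> z2^3^3 \<Rightarrow> (z2^3) \<times> (z2^3 \<Rightarrow> z2)" where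
  "DI4_marking m \<tau> = (factor2_coordinate (fst (m (\<psi> \<tau>))), \<lambda>y. snd (m (\<psi> \<tau>)) (G *v y))"

lemma DI4_marking_is_marking:
  assumes "marked_on UNIV W m" "\<tau> \<in> WD" "is_reflection \<tau>"
  shows "is_marking_on UNIV \<tau> (fst (DI4_marking m \<tau>)) (snd (DI4_marking m \<tau>))"
proof -
  note marking = marking_of_\<psi>_reflection[OF assms]
  let ?b = "fst (m (\<psi> \<tau>))" and ?\<beta> = "snd (m (\<psi> \<tau>))"
  have update: "\<psi> \<tau> *v x = x + ?\<beta> x *s ?b" and add: "?\<beta> (x + x') = ?\<beta> x + ?\<beta> x'"
    and smult: "?\<beta> (c *s x) = c * ?\<beta> x" for x x' c
    using marking(1) unfolding is_marking_on_def lin_on_def by blast+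
  have "\<tau> *v y = y + ?\<beta> (G *v y) *s factor2_coordinate ?b" for y
  proof -
    have "G *v (\<tau> *v y) = G *v y + ?\<beta> (G *v y) *s ?b"
      by (simp add: G_intertwines_vec[OF \<open>\<tau> \<in> WD\<close>, symmetric] update)
    also have "\<dots> = G *v (y + ?\<beta> (G *v y) *s factor2_coordinate ?b)"
      by (simp add: matrix_vector_right_distrib matrix_vector_mult_smult G_factor2_coordinate_S2[OF marking(2)])
    finally show ?thesis
      by simp
  qed
  then show ?thesis
    unfolding is_marking_on_def lin_on_def DI4_marking_def
    by (simp add: add smult matrix_vector_right_distrib matrix_vector_mult_smult)
qed

lemma DI4_marking_conjugate:
  assumes "marked_on UNIV W m" "w \<in> WD" "\<tau> \<in> WD" "\<tau>' \<in> WD" "is_reflection \<tau>"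
    and "\<tau>' ** w = w ** \<tau>"
  shows "\<exists>u. z2_unit u \<and> fst (DI4_marking m \<tau>') = u *s (w *v fst (DI4_marking m \<tau>)) \<and>
    (\<forall>y\<in>UNIV. snd (DI4_marking m \<tau>) y = u * snd (DI4_marking m \<tau>') (w *v y))"
proof -
  have "\<psi> \<tau>' ** \<psi> w = \<psi> w ** \<psi> \<tau>"
    using assms(2-4,6) \<psi>_mult[of \<tau>' w] \<psi>_mult[of w \<tau>] by simp
  moreover have "\<psi> w \<in> W" "\<psi> \<tau> \<in> W" "\<psi> \<tau>' \<in> W"
    using \<psi>_maps W2_subset assms(2-4) by blast+
  ultimately obtain u where u: "z2_unit u" "fst (m (\<psi> \<tau>')) = u *s (\<psi> w *v fst (m (\<psi> \<tau>)))"
    "\<forall>x. snd (m (\<psi> \<tau>)) x = u * snd (m (\<psi> \<tau>')) (\<psi> w *v x)"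
    using marked_on_conjugate[OF assms(1)] \<psi>_reflection[OF assms(3,5)] by blast
  let ?b = "factor2_coordinate (fst (m (\<psi> \<tau>)))"
  have "fst (m (\<psi> \<tau>')) = u *s (\<psi> w *v (G *v ?b))"
    using u(2) G_factor2_coordinate_S2[OF marking_of_\<psi>_reflection(2)[OF assms(1,3,5)]] by simp
  also have "\<dots> = G *v (u *s (w *v ?b))"
    by (simp add: G_intertwines_vec[OF \<open>w \<in> WD\<close>] matrix_vector_mult_smult)
  finally have "fst (DI4_marking m \<tau>') = u *s (w *v fst (DI4_marking m \<tau>))"
    by (simp add: DI4_marking_def)
  moreover have "snd (DI4_marking m \<tau>) y = u * snd (DI4_marking m \<tau>') (w *v y)" for y
    using u(3) by (simp add: DI4_marking_def G_intertwines_vec[OF \<open>w \<in> WD\<close>])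
  ultimately show ?thesis
    using u(1) by blast
qed

lemma DI4_marking_marked:
  assumes "marked_on UNIV W m"
  shows "marked_on UNIV WD (DI4_marking m)"
  unfolding marked_on_def using DI4_marking_is_marking[OF assms] DI4_marking_conjugate[OF assms]
  by blast

lemma marks_respected_restrictions:
  assumes "marked_on UNIV W m"
  shows "marks_respected S1 S2 G \<psi> W1 WD m m (DI4_marking m)"
  unfolding marks_respected_def
proof (intro conjI ballI impI)
  fix \<sigma>
  assume "\<sigma> \<in> W1" "is_reflection \<sigma>"
  then have marking: "is_marking_on UNIV \<sigma> (fst (m \<sigma>)) (snd (m \<sigma>))"
    using marked_on_marking[OF assms] W1_subset by blast
  have "snd (m \<sigma>) (lat_proj1 S1 S2 x) = snd (m \<sigma>) x" for x
    using marking_in_factor(2)[OF S1_saturated S2_saturated rational_span \<open>is_reflection \<sigma>\<close> _ _ marking]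
      W1_preserves_S1 W1_fixes_S2 \<open>\<sigma> \<in> W1\<close> marking
    by (intro additive_vanishing_on_summand2) (auto simp: is_marking_on_def lin_on_def)
  then show "mark_eq_on UNIV (fst (m \<sigma>), \<lambda>x. snd (m \<sigma>) (lat_proj1 S1 S2 x)) (m \<sigma>)"
    unfolding mark_eq_on_def by (intro exI[of _ 1]) (simp add: z2_unit_def)
next
  fix \<tau>
  assume "\<tau> \<in> WD" "is_reflection \<tau>"
  note marking = marking_of_\<psi>_reflection[OF assms this]
  have "snd (m (\<psi> \<tau>)) (G *v factor2_coordinate x) = snd (m (\<psi> \<tau>)) x" for x
    unfolding G_factor2_coordinate using marking
    by (intro additive_vanishing_on_summand1) (auto simp: is_marking_on_def lin_on_def)
  moreover have "G *v factor2_coordinate (fst (m (\<psi> \<tau>))) = fst (m (\<psi> \<tau>))"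
    using G_factor2_coordinate_S2[OF marking(2)] .
  ultimately show "mark_eq_on UNIV (G *v fst (DI4_marking m \<tau>),
      \<lambda>x. snd (DI4_marking m \<tau>) (THE y. G *v y = x - lat_proj1 S1 S2 x)) (m (\<psi> \<tau>))"
    unfolding mark_eq_on_def DI4_marking_def factor2_coordinate_def[symmetric]
    by (intro exI[of _ 1]) (simp add: z2_unit_def)
qed

lemma marks_respected_unique:
  assumes "marks_respected S1 S2 G \<psi> W1 WD m m1 m2"
  shows "\<sigma> \<in> W1 \<Longrightarrow> is_reflection \<sigma> \<Longrightarrow> mark_eq_on S1 (m \<sigma>) (m1 \<sigma>)"
    and "\<tau> \<in> WD \<Longrightarrow> is_reflection \<tau> \<Longrightarrow> mark_eq_on UNIV (DI4_marking m \<tau>) (m2 \<tau>)"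
proof -
  assume "\<sigma> \<in> W1" "is_reflection \<sigma>"
  then obtain u where u: "z2_unit u" "fst (m \<sigma>) = u *s fst (m1 \<sigma>)"
    "\<forall>x. snd (m1 \<sigma>) (lat_proj1 S1 S2 x) = u * snd (m \<sigma>) x"
    using assms unfolding marks_respected_def mark_eq_on_def by auto
  have "snd (m1 \<sigma>) x = u * snd (m \<sigma>) x" if "x \<in> S1" for x
    using u(3)[rule_format, of x] lat_proj1_summand1[OF that] by simp
  then have "mark_eq_on S1 (m1 \<sigma>) (m \<sigma>)"
    unfolding mark_eq_on_def using u(1,2) by blast
  then show "mark_eq_on S1 (m \<sigma>) (m1 \<sigma>)"
    by (rule mark_eq_on_sym)
next
  assume "\<tau> \<in> WD" "is_reflection \<tau>"
  then obtain u where u: "z2_unit u" "fst (m (\<psi> \<tau>)) = u *s (G *v fst (m2 \<tau>))"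
    "\<forall>x. snd (m2 \<tau>) (factor2_coordinate x) = u * snd (m (\<psi> \<tau>)) x"
    using assms unfolding marks_respected_def mark_eq_on_def factor2_coordinate_def[symmetric] by auto
  have "fst (DI4_marking m \<tau>) = u *s fst (m2 \<tau>)"
    using u(2) by (simp add: DI4_marking_def flip: matrix_vector_mult_smult)
  moreover have "snd (m2 \<tau>) y = u * snd (DI4_marking m \<tau>) y" for y
    using u(3)[rule_format, of "G *v y"] by (simp add: DI4_marking_def)
  ultimately have "mark_eq_on UNIV (m2 \<tau>) (DI4_marking m \<tau>)"
    unfolding mark_eq_on_def using u(1) by blast
  then show "mark_eq_on UNIV (DI4_marking m \<tau>) (m2 \<tau>)"
    by (rule mark_eq_on_sym)
qed


lemma marking_factors_exist_unique:
  assumes "marked_on UNIV W m"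
  shows "\<exists>m1 m2. marked_on S1 W1 m1 \<and> marked_on UNIV WD m2 \<and>
    marks_respected S1 S2 G \<psi> W1 WD m m1 m2 \<and>
    (\<forall>m1' m2'. marked_on S1 W1 m1' \<and> marked_on UNIV WD m2' \<and>
        marks_respected S1 S2 G \<psi> W1 WD m m1' m2' \<longrightarrow>
      (\<forall>\<sigma>\<in>W1. is_reflection \<sigma> \<longrightarrow> mark_eq_on S1 (m1 \<sigma>) (m1' \<sigma>)) \<and>
      (\<forall>\<tau>\<in>WD. is_reflection \<tau> \<longrightarrow> mark_eq_on UNIV (m2 \<tau>) (m2' \<tau>)))"
proof (intro exI[of _ m] exI[of _ "DI4_marking m"] conjI allI impI ballI)
  show "marked_on S1 W1 m"
    by (rule marked_on_W1[OF assms])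
  show "marked_on UNIV WD (DI4_marking m)"
    by (rule DI4_marking_marked[OF assms])
  show "marks_respected S1 S2 G \<psi> W1 WD m m (DI4_marking m)"
    by (rule marks_respected_restrictions[OF assms])
  fix m1 m2
  assume "marked_on S1 W1 m1 \<and> marked_on UNIV WD m2 \<and> marks_respected S1 S2 G \<psi> W1 WD m m1 m2"
  then have respected: "marks_respected S1 S2 G \<psi> W1 WD m m1 m2"
    by blast
  show "mark_eq_on S1 (m \<sigma>) (m1 \<sigma>)" if "\<sigma> \<in> W1" "is_reflection \<sigma>" for \<sigma>
    using marks_respected_unique(1)[OF respected that] .
  show "mark_eq_on UNIV (DI4_marking m \<tau>) (m2 \<tau>)" if "\<tau> \<in> WD" "is_reflection \<tau>" for \<tau>
    using marks_respected_unique(2)[OF respected that] .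
qed

end

lemma rational_product_of_rat_decomp:
  assumes "W = mgen {\<sigma>\<in>W. is_reflection \<sigma>}" and "rat_decomp W S1 S2 W1 W2"
  shows "rational_product W S1 S2 W1 W2"
proof (rule rational_product.intro)
  show "W = mgen {\<sigma>\<in>W. is_reflection \<sigma>}"
    by (rule assms(1))
qed (use assms(2) in \<open>auto simp: rat_decomp_def\<close>)

lemma DI4_factorI:
  assumes "is_crl W" "DI4_like WD" "rat_decomp W S1 S2 W1 W2"
    and G: "inj ((*v) G)" "\<And>y. G *v y \<in> S2" "\<And>x. x \<in> S2 \<Longrightarrow> \<exists>c. c \<noteq> 0 \<and> c *s x \<in> range ((*v) G)"
    "\<And>u. u \<in> WD \<Longrightarrow> \<psi> u ** G = G ** u" "mat_red G \<noteq> 0"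
    and \<psi>: "bij_betw \<psi> WD W2" "\<forall>a\<in>WD. \<forall>b\<in>WD. \<psi> (a ** b) = \<psi> a ** \<psi> b"
  shows "DI4_factor W S1 S2 W1 W2 WD G \<psi>"
proof (intro DI4_factor.intro DI4_factor_axioms.intro)
  have "W = mgen {\<sigma>\<in>W. is_reflection \<sigma>}"
    using assms(1) unfolding is_crl_def by (elim conjE) assumption
  then show "rational_product W S1 S2 W1 W2"
    using assms(3) by (rule rational_product_of_rat_decomp)
  have "\<forall>w\<in>W. lat_aut w"
    using assms(1) unfolding is_crl_def by (elim conjE) assumption
  then show "\<And>w. w \<in> W \<Longrightarrow> lat_aut w"
    by blast
  show "mat_red ` WD = {M. det M \<noteq> 0}"
    using assms(2) unfolding DI4_like_def by (elim conjE) assumption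
  have "{A\<in>WD. mat_red A = mat 1} = {mat 1, - mat 1}"
    using assms(2) unfolding DI4_like_def by (elim conjE) assumption
  then show "- mat 1 \<in> WD"
    by blast
  show "\<And>u. u \<in> WD \<Longrightarrow> \<psi> u \<in> W2"
    using \<psi>(1) by (auto simp: bij_betw_def)
  show "\<And>a b. a \<in> WD \<Longrightarrow> b \<in> WD \<Longrightarrow> \<psi> (a ** b) = \<psi> a ** \<psi> b"
    using \<psi>(2) by blast
qed (fact G)+

lemma DI4_factor_of_rat_iso:
  fixes W :: "(z2^'n^'n) set" and WD :: "(z2^3^3) set" and S2 :: "(z2^'n) set"
  assumes "is_crl W" "DI4_like WD" "rat_decomp W S1 S2 W1 W2" "rat_iso WD S2 W2"
  obtains G \<psi> where "DI4_factor W S1 S2 W1 W2 WD G \<psi>" and "bij_betw \<psi> WD W2"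
proof -
  obtain F :: "z2^3^'n" and \<psi> where F: "inj ((*v) F)" "range ((*v) F) \<subseteq> S2"
      "\<forall>x\<in>S2. \<exists>c. c \<noteq> 0 \<and> c *s x \<in> range ((*v) F)" "\<forall>u\<in>WD. \<psi> u ** F = F ** u"
    and \<psi>: "bij_betw \<psi> WD W2" "\<forall>a\<in>WD. \<forall>b\<in>WD. \<psi> (a ** b) = \<psi> a ** \<psi> b"
    using assms(4) unfolding rat_iso_def by blast
  have "saturated S2"
    using assms(3) unfolding rat_decomp_def by (elim conjE) assumption
  obtain G where G: "inj ((*v) G)" "\<And>y. G *v y \<in> S2"
    "\<And>x. x \<in> S2 \<Longrightarrow> \<exists>c. c \<noteq> 0 \<and> c *s x \<in> range ((*v) G)"
    "\<And>u. u \<in> WD \<Longrightarrow> \<psi> u ** G = G ** u" "mat_red G \<noteq> 0"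
    using rat_iso_primitive[OF \<open>saturated S2\<close> F] by metis
  then show thesis
    using that DI4_factorI[OF assms(1-3) G \<psi>] \<psi>(1) by blast
qed

theorem lemma7p7:
  fixes W :: "(z2^'n^'n) set" and WD :: "(z2^3^3) set"
    and S1 S2 :: "(z2^'n) set" and W1 W2 :: "(z2^'n^'n) set"
  assumes "is_crl W"
    and "DI4_like WD"
    and "rat_decomp W S1 S2 W1 W2"
    and "rat_iso WD S2 W2"
  shows "(\<forall>x. \<exists>a\<in>S1. \<exists>b\<in>S2. x = a + b) \<and>
    W1 = mgen {\<sigma>\<in>W1. is_reflection \<sigma>} \<and>
    (\<exists>(G :: z2^3^'n) \<psi>.
       bij_betw ((*v) G) UNIV S2 \<and> bij_betw \<psi> WD W2 \<and>
       (\<forall>a\<in>WD. \<forall>b\<in>WD. \<psi> (a ** b) = \<psi> a ** \<psi> b) \<and>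
       (\<forall>u\<in>WD. \<psi> u ** G = G ** u) \<and>
       (\<forall>m. marked_on UNIV W m \<longrightarrow>
          (\<exists>m1 m2. marked_on S1 W1 m1 \<and> marked_on UNIV WD m2 \<and>
             marks_respected S1 S2 G \<psi> W1 WD m m1 m2 \<and>
             (\<forall>m1' m2'. marked_on S1 W1 m1' \<and> marked_on UNIV WD m2' \<and>
                 marks_respected S1 S2 G \<psi> W1 WD m m1' m2' \<longrightarrow>
                (\<forall>\<sigma>\<in>W1. is_reflection \<sigma> \<longrightarrow> mark_eq_on S1 (m1 \<sigma>) (m1' \<sigma>)) \<and>
                (\<forall>\<tau>\<in>WD. is_reflection \<tau> \<longrightarrow> mark_eq_on UNIV (m2 \<tau>) (m2' \<tau>))))))"
proof -
  obtain G \<psi> where "DI4_factor W S1 S2 W1 W2 WD G \<psi>" and "bij_betw \<psi> WD W2"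
    using DI4_factor_of_rat_iso[OF assms] .
  then interpret DI4_factor W S1 S2 W1 W2 WD G \<psi>
    by simp
  show ?thesis
  proof (intro conjI exI[of _ G] exI[of _ \<psi>] allI impI ballI)
    show "\<exists>a\<in>S1. \<exists>b\<in>S2. x = a + b" for x
      by (rule lattice_decomposition)
  qed (use W1_generated G_bij \<open>bij_betw \<psi> WD W2\<close> \<psi>_mult G_intertwines marking_factors_exist_unique
      in blast)+
qed

end
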